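(* There exist absolute constants $c,C>0$ such that for every integer $k\geq 2$ there is $n_0=n_0(k)$ such that for all integers $n\geq n_0$, $$c\, k^3 n^2 \leq \hat r(S_n^{(k)}) \leq C\, k^3 n^2 .$$ That is, for every fixed $k\ge 2$ and all sufficiently large $n$, $\hat r(S_n^{(k)})=\Theta(k^3n^2)$, with implied constants independent of $k$ and $n$.
   Context: All graphs are finite and simple. For positive integers $k$ and $n$, the starburst graph $S_n^{(k)}$ is obtained from $K_k$ by adding $n$ pendant edges to every vertex of $K_k$ (so it has $kn+k$ vertices). A copy of $H$ in $G$ means a (not necessarily induced) subgraph of $G$ isomorphic to $H$. A graph $G$ is Ramsey for a graph $H$ if every two-coloring of the edges of $G$ contains a monochromatic copy of $H$. The size Ramsey number $\hat r(H)$ is the minimum number of edges in a graph $G$ which is Ramsey for $H$. *)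

theory Defs
  imports Complex_Main "HOL-Library.Ramsey"
begin

text \<open>A graph is a pair of a vertex set and a set of edges, each edge being a two-element set of
  vertices; \<^term>\<open>nsets V 2\<close> is the set of all two-element subsets of \<^term>\<open>V\<close>.\<close>

type_synonym 'a graph = "'a set \<times> 'a set set"

abbreviation verts :: "'a graph \<Rightarrow> 'a set" where
  "verts G \<equiv> fst G"

abbreviation edges :: "'a graph \<Rightarrow> 'a set set" where
  "edges G \<equiv> snd G"

definition simple_graph :: "'a graph \<Rightarrow> bool" where
  "simple_graph G \<longleftrightarrow> finite (verts G) \<and> edges G \<subseteq> nsets (verts G) 2"

definition subgraph :: "'a graph \<Rightarrow> 'a graph \<Rightarrow> bool" where
  "subgraph F G \<longleftrightarrow> simple_graph F \<and> simple_graph G \<and>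
     verts F \<subseteq> verts G \<and> edges F \<subseteq> edges G"

definition isomorphic :: "'a graph \<Rightarrow> 'b graph \<Rightarrow> bool" where
  "isomorphic G H \<longleftrightarrow> (\<exists>f. bij_betw f (verts G) (verts H) \<and>
     (\<forall>u\<in>verts G. \<forall>v\<in>verts G. {u, v} \<in> edges G \<longleftrightarrow> {f u, f v} \<in> edges H))"

definition is_copy :: "'a graph \<Rightarrow> 'b graph \<Rightarrow> 'a graph \<Rightarrow> bool" where
  "is_copy F H G \<longleftrightarrow> subgraph F G \<and> isomorphic F H"

text \<open>The values of the colouring \<^term>\<open>\<chi>\<close> outside \<^term>\<open>edges G\<close> are irrelevant.\<close>

definition is_ramsey_for :: "'a graph \<Rightarrow> 'b graph \<Rightarrow> bool" where
  "is_ramsey_for G H \<longleftrightarrow>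
     (\<forall>\<chi> :: 'a set \<Rightarrow> bool. \<exists>F. is_copy F H G \<and> (\<exists>b. \<forall>e\<in>edges F. \<chi> e = b))"

text \<open>Every finite graph is isomorphic to one with vertices in \<^typ>\<open>nat\<close>, and being Ramsey for
  \<^term>\<open>H\<close> as well as the number of edges are invariant under isomorphism, so restricting the host
  graphs to this vertex type loses nothing. By Ramsey's theorem the minimum is over a nonempty set
  for every simple graph \<^term>\<open>H\<close>.\<close>

definition size_ramsey :: "'a graph \<Rightarrow> nat" where
  "size_ramsey H =
     (LEAST m. \<exists>G :: nat graph. simple_graph G \<and> is_ramsey_for G H \<and> card (edges G) = m)"

text \<open>\<^term>\<open>starburst k n\<close> is $S_n^{(k)}$: the vertices \<^term>\<open>(i, 0)\<close> with \<^term>\<open>i < k\<close> form the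
  complete graph, and \<^term>\<open>(i, 1)\<close> to \<^term>\<open>(i, n)\<close> are the leaves attached to \<^term>\<open>(i, 0)\<close>.\<close>

definition starburst :: "nat \<Rightarrow> nat \<Rightarrow> (nat \<times> nat) graph" where
  "starburst k n =
     ({..<k} \<times> {0..n},
      nsets ({..<k} \<times> {0}) 2 \<union> {{(i, 0), (i, j)} | i j. i < k \<and> 1 \<le> j \<and> j \<le> n})"

lemma simple_graph_starburst: "simple_graph (starburst k n)"
  by (auto simp: simple_graph_def starburst_def nsets_def)

lemma card_verts_starburst: "card (verts (starburst k n)) = k * n + k"
  by (simp add: starburst_def)

end

theory Submission
  imports Defs "HOL-Analysis.Convex" "HOL-Computational_Algebra.Primes"
begin

text \<open>
  Lower bound. Let \<open>q\<close> and \<open>p\<close> be about \<open>k / 2\<close> with \<open>p + q = k - 1\<close>. If fewer than \<open>p k n\<close> vertices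
  of \<open>G\<close> have degree at least \<open>q n\<close>, split these into \<open>p\<close> parts of size at most \<open>k n\<close> and the other
  vertices into \<open>q\<close> parts minimising the number of internal edges, so that each of them has fewer
  than \<open>n\<close> neighbours in its own part. Colour an edge by whether it lies inside a part: the edges
  between parts contain no \<open>K\<^sub>k\<close>, and no part contains a starburst. Hence \<open>G\<close> has at least about
  \<open>p k n \<cdot> q n / 2\<close> edges.

  Upper bound. Take \<open>r\<close> of the parallel classes of lines of an affine plane of large prime order \<open>q\<close>
  (large in terms of \<open>k\<close> only), with \<open>r / q\<close> about \<open>1 / (4 k)\<close>, blow up each point to \<open>b\<close> vertices so
  that there are \<open>N = q\<^sup>2 b\<close> vertices, of order \<open>k\<^sup>2 n\<close>, and join two vertices if they share a line. A
  second moment computation shows that, for a given set \<open>W\<close> that is not too small, few vertices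
  have more than \<open>2 (r / q) |W|\<close> neighbours in \<open>W\<close>. Applied to the coloured neighbourhoods this
  makes almost all pairs \<open>good\<close>: in a monochromatic clique of size \<open>k\<close> with good pairs
  and with colour degrees at least \<open>2 (n + k)\<close>, half of the coloured neighbourhood of each vertex
  avoids those of the other vertices, which gives a starburst. Such a clique is found on a line. On
  the vertices of large degree in only one colour, Turan's theorem on every line would otherwise
  produce more pairs that are bad or of the wrong colour than there are; on the
  vertices of large degree in both colours one uses Ramsey's theorem and Turan's theorem.
\<close>

section \<open>Copies of starbursts\<close>

text \<open>Copies need not be induced, so an injection that preserves edges suffices: keeping only
  the images of edges of \<open>H\<close> makes the image isomorphic to \<open>H\<close>.\<close>

lemma is_copy_image:
  assumes "simple_graph G" "simple_graph H" and inj: "inj_on g (verts H)"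
    and gV: "g ` verts H \<subseteq> verts G" and gE: "\<And>e. e \<in> edges H \<Longrightarrow> g ` e \<in> edges G"
  shows "is_copy (g ` verts H, (`) g ` edges H) H G"
proof -
  have EH: "e \<subseteq> verts H" "card e = 2" if "e \<in> edges H" for e
    using assms(2) that by (auto simp: simple_graph_def nsets_def)
  have "simple_graph (g ` verts H, (`) g ` edges H)"
    using assms(2) EH inj
    by (auto simp: simple_graph_def nsets_def card_image inj_on_subset dest: finite_subset)
  moreover have "isomorphic (g ` verts H, (`) g ` edges H) H"
    unfolding isomorphic_def
  proof (intro exI[of _ "inv_into (verts H) g"] conjI ballI)
    show "bij_betw (inv_into (verts H) g) (verts (g ` verts H, (`) g ` edges H)) (verts H)"
      using inj by (simp add: bij_betw_inv_into inj_on_imp_bij_betw)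
  next
    fix u v
    assume "u \<in> verts (g ` verts H, (`) g ` edges H)" "v \<in> verts (g ` verts H, (`) g ` edges H)"
    then obtain a b where ab: "a \<in> verts H" "b \<in> verts H" "u = g a" "v = g b" by auto
    have "{g a, g b} \<in> (`) g ` edges H \<longleftrightarrow> {a, b} \<in> edges H"
    proof
      assume "{g a, g b} \<in> (`) g ` edges H"
      then obtain e where e: "e \<in> edges H" "g ` e = g ` {a, b}" by auto
      have "{a, b} \<subseteq> verts H" using ab by simp
      then have "e = {a, b}"
        using inj_on_image_eq_iff[OF inj EH(1)[OF e(1)]] e(2) by blast
      with e show "{a, b} \<in> edges H" by simp
    next
      assume "{a, b} \<in> edges H"
      then have "g ` {a, b} \<in> (`) g ` edges H" by (rule imageI)
      then show "{g a, g b} \<in> (`) g ` edges H" by simp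
    qed
    then show "{u, v} \<in> edges (g ` verts H, (`) g ` edges H) \<longleftrightarrow>
        {inv_into (verts H) g u, inv_into (verts H) g v} \<in> edges H"
      using ab inj by (simp add: inv_into_f_f)
  qed
  ultimately show ?thesis
    using assms by (auto simp: is_copy_def subgraph_def)
qed

lemma is_copyE:
  assumes "is_copy F H G"
  obtains g where "inj_on g (verts H)" "g ` verts H \<subseteq> verts G"
    "\<And>u v. u \<in> verts H \<Longrightarrow> v \<in> verts H \<Longrightarrow> {u, v} \<in> edges H \<Longrightarrow> {g u, g v} \<in> edges F"
proof -
  from assms obtain f where f: "bij_betw f (verts F) (verts H)"
    "\<And>u v. u \<in> verts F \<Longrightarrow> v \<in> verts F \<Longrightarrow> {u, v} \<in> edges F \<longleftrightarrow> {f u, f v} \<in> edges H"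
    and sub: "verts F \<subseteq> verts G"
    by (auto simp: is_copy_def isomorphic_def subgraph_def)
  let ?g = "inv_into (verts F) f"
  have bij: "bij_betw ?g (verts H) (verts F)"
    using f(1) by (rule bij_betw_inv_into)
  show ?thesis
  proof (rule that)
    show "inj_on ?g (verts H)" "?g ` verts H \<subseteq> verts G"
      using bij sub by (auto simp: bij_betw_def)
    fix u v assume uv: "u \<in> verts H" "v \<in> verts H" "{u, v} \<in> edges H"
    have "?g u \<in> verts F" "?g v \<in> verts F" "f (?g u) = u" "f (?g v) = v"
      using uv bij f(1) by (auto simp: bij_betw_def f_inv_into_f)
    with uv f(2) show "{?g u, ?g v} \<in> edges F" by metis
  qed
qed

text \<open>Turns the Ramsey property into an explicit monochromatic embedding, with core and
  pendant edges listed separately. Both colourings of the lower bound are analysed through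
  it.\<close>

lemma ramsey_starburstE:
  fixes \<chi> :: "'a set \<Rightarrow> bool"
  assumes "is_ramsey_for G (starburst k n)"
  obtains g \<beta> where "inj_on g ({..<k} \<times> {0..n})" "g ` ({..<k} \<times> {0..n}) \<subseteq> verts G"
    "\<And>i j. i < k \<Longrightarrow> j < k \<Longrightarrow> i \<noteq> j \<Longrightarrow>
       {g (i, 0), g (j, 0)} \<in> edges G \<and> \<chi> {g (i, 0), g (j, 0)} = \<beta>"
    "\<And>i j. i < k \<Longrightarrow> 1 \<le> j \<Longrightarrow> j \<le> n \<Longrightarrow>
       {g (i, 0), g (i, j)} \<in> edges G \<and> \<chi> {g (i, 0), g (i, j)} = \<beta>"
proof -
  obtain F \<beta> where F: "is_copy F (starburst k n) G" "\<forall>e\<in>edges F. \<chi> e = \<beta>"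
    using assms[unfolded is_ramsey_for_def, THEN spec, of \<chi>] by (elim exE conjE)
  have FG: "edges F \<subseteq> edges G"
    using F(1) by (simp add: is_copy_def subgraph_def)
  obtain g where g: "inj_on g (verts (starburst k n))"
    "g ` verts (starburst k n) \<subseteq> verts G"
    "\<And>u v. u \<in> verts (starburst k n) \<Longrightarrow> v \<in> verts (starburst k n) \<Longrightarrow>
       {u, v} \<in> edges (starburst k n) \<Longrightarrow> {g u, g v} \<in> edges F"
    using F(1) by (rule is_copyE) blast
  show ?thesis
  proof (rule that)
    show "inj_on g ({..<k} \<times> {0..n})" "g ` ({..<k} \<times> {0..n}) \<subseteq> verts G"
      using g(1,2) by (auto simp: starburst_def)
  next
    fix i j assume "i < k" "j < k" "i \<noteq> j"
    then have "{g (i, 0), g (j, 0)} \<in> edges F"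
      by (intro g(3)) (auto simp: starburst_def nsets_def)
    with F(2) FG show "{g (i, 0), g (j, 0)} \<in> edges G \<and> \<chi> {g (i, 0), g (j, 0)} = \<beta>" by blast
  next
    fix i j assume "i < k" "1 \<le> j" "j \<le> n"
    then have "{g (i, 0), g (i, j)} \<in> edges F"
      by (intro g(3)) (auto simp: starburst_def)
    with F(2) FG show "{g (i, 0), g (i, j)} \<in> edges G \<and> \<chi> {g (i, 0), g (i, j)} = \<beta>" by blast
  qed
qed

text \<open>The converse direction: disjoint \<open>n\<close>-sets \<open>A v\<close> outside the
  core \<open>K\<close> serve as leaf sets, and arbitrary numberings of \<open>K\<close> and of each
  \<open>A v\<close> give the labelling.\<close>

lemma starburst_copyI:
  fixes \<chi> :: "'a set \<Rightarrow> bool"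
  assumes G: "simple_graph G" and K: "K \<subseteq> verts G" "finite K" "card K = k"
    and A: "\<And>v. v \<in> K \<Longrightarrow> A v \<subseteq> verts G" "\<And>v. v \<in> K \<Longrightarrow> card (A v) = n"
      "\<And>v. v \<in> K \<Longrightarrow> A v \<inter> K = {}"
    and disj: "\<And>u v. u \<in> K \<Longrightarrow> v \<in> K \<Longrightarrow> u \<noteq> v \<Longrightarrow> A u \<inter> A v = {}"
    and core: "\<And>u v. u \<in> K \<Longrightarrow> v \<in> K \<Longrightarrow> u \<noteq> v \<Longrightarrow> {u, v} \<in> edges G \<and> \<chi> {u, v} = \<beta>"
    and leaf: "\<And>v w. v \<in> K \<Longrightarrow> w \<in> A v \<Longrightarrow> {v, w} \<in> edges G \<and> \<chi> {v, w} = \<beta>"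
  shows "\<exists>F. is_copy F (starburst k n) G \<and> (\<exists>b. \<forall>e\<in>edges F. \<chi> e = b)"
proof -
  have finA: "finite (A v)" if "v \<in> K" for v
    using A(1)[OF that] G finite_subset by (auto simp: simple_graph_def)
  obtain h where h: "bij_betw h {..<k} K"
    using K(2,3) by (metis ex_bij_betw_nat_finite lessThan_atLeast0)
  have "\<forall>v\<in>K. \<exists>l. bij_betw l {1..n} (A v)"
    using A(2) ex_bij_betw_nat_finite_1[OF finA] by fastforce
  from bchoice[OF this] obtain l where l: "\<And>v. v \<in> K \<Longrightarrow> bij_betw (l v) {1..n} (A v)"
    by blast
  define g where "g = (\<lambda>(i, j). if j = 0 then h i else l (h i) j)"
  have hK: "h i \<in> K" if "i < k" for i using h that by (auto simp: bij_betw_def)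
  have hinj: "h i = h i' \<longleftrightarrow> i = i'" if "i < k" "i' < k" for i i'
    using h that by (auto simp: bij_betw_def inj_on_def)
  have lA: "l v j \<in> A v" if "v \<in> K" "1 \<le> j" "j \<le> n" for v j
    using l[OF that(1)] that by (auto simp: bij_betw_def)
  have linj: "j = j'" if "v \<in> K" "l v j = l v j'" "1 \<le> j" "j \<le> n" "1 \<le> j'" "j' \<le> n" for v j j'
    using l[OF that(1)] that(2-) by (auto dest!: bij_betw_imp_inj_on inj_onD)
  let ?S = "starburst k n"
  have VS: "verts ?S = {..<k} \<times> {0..n}" by (simp add: starburst_def)
  have inj: "inj_on g (verts ?S)"
  proof (rule inj_onI)
    fix x y assume xy: "x \<in> verts ?S" "y \<in> verts ?S" "g x = g y"
    obtain i j i' j' where eq: "x = (i, j)" "y = (i', j')" by fastforce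
    have b: "i < k" "i' < k" "j \<le> n" "j' \<le> n" using xy eq VS by auto
    consider "j = 0" "j' = 0" | "j = 0" "1 \<le> j'" | "1 \<le> j" "j' = 0" | "1 \<le> j" "1 \<le> j'"
      by linarith
    then show "x = y"
    proof cases
      case 1 then show ?thesis using xy(3) b hinj by (simp add: g_def eq)
    next
      case 2
      then have "h i = l (h i') j'" using xy(3) by (simp add: g_def eq)
      then show ?thesis using lA[OF hK[OF b(2)] 2(2) b(4)] A(3)[OF hK[OF b(2)]] hK[OF b(1)] by auto
    next
      case 3
      then have "h i' = l (h i) j" using xy(3) by (simp add: g_def eq)
      then show ?thesis using lA[OF hK[OF b(1)] 3(1) b(3)] A(3)[OF hK[OF b(1)]] hK[OF b(2)] by auto
    next
      case 4
      then have e: "l (h i) j = l (h i') j'" using xy(3) by (simp add: g_def eq)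
      have "h i = h i'"
        using lA[OF hK[OF b(1)] 4(1) b(3)] lA[OF hK[OF b(2)] 4(2) b(4)] e
          disj[OF hK[OF b(1)] hK[OF b(2)]] by auto
      then have "i = i'" using hinj b by simp
      moreover have "j = j'" using linj[OF hK[OF b(1)]] e 4 b \<open>i = i'\<close> by simp
      ultimately show ?thesis by (simp add: eq)
    qed
  qed
  have edge: "g ` e \<in> edges G \<and> \<chi> (g ` e) = \<beta>" if "e \<in> edges ?S" for e
  proof -
    from that consider i i' where "e = {(i, 0), (i', 0)}" "i < k" "i' < k" "i \<noteq> i'"
      | i j where "e = {(i, 0), (i, j)}" "i < k" "1 \<le> j" "j \<le> n"
      by (auto simp: starburst_def nsets_def card_2_iff)
    then show ?thesis
    proof cases
      case 1
      then show ?thesis using core[OF hK hK] hinj by (simp add: g_def)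
    next
      case 2
      then show ?thesis using leaf[OF hK lA[OF hK]] by (simp add: g_def)
    qed
  qed
  have gV: "g ` verts ?S \<subseteq> verts G"
  proof
    fix x assume "x \<in> g ` verts ?S"
    then obtain i j where ij: "i < k" "j \<le> n" "x = g (i, j)" by (auto simp: VS)
    show "x \<in> verts G"
      using hK[OF ij(1)] K(1) lA[OF hK[OF ij(1)]] A(1)[OF hK[OF ij(1)]] ij
      by (cases "j = 0") (auto simp: g_def)
  qed
  have "is_copy (g ` verts ?S, (`) g ` edges ?S) ?S G"
    using is_copy_image[OF G simple_graph_starburst inj gV] edge by blast
  with edge show ?thesis by (intro exI[of _ "(g ` verts ?S, (`) g ` edges ?S)"]) auto
qed

section \<open>The lower bound\<close>

definition incident :: "'a graph \<Rightarrow> 'a \<Rightarrow> 'a set set" where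
  "incident G v = {e \<in> edges G. v \<in> e}"

lemma finite_edges:
  assumes "simple_graph G"
  shows "finite (edges G)"
proof (rule finite_subset)
  show "edges G \<subseteq> nsets (verts G) 2" using assms by (simp add: simple_graph_def)
  show "finite (nsets (verts G) 2)"
    using assms by (intro finite_imp_finite_nsets) (simp add: simple_graph_def)
qed

lemma handshake:
  assumes "simple_graph G"
  shows "(\<Sum>v\<in>verts G. card (incident G v)) = 2 * card (edges G)"
proof -
  have fin: "finite (verts G)" "finite (edges G)"
    using assms finite_edges[OF assms] by (simp_all add: simple_graph_def)
  have "card {v \<in> verts G. v \<in> e} = 2" if "e \<in> edges G" for e
  proof -
    have "e \<in> nsets (verts G) 2" using assms that by (auto simp: simple_graph_def)
    then have "{v \<in> verts G. v \<in> e} = e" "card e = 2" by (auto simp: nsets_def)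
    then show ?thesis by simp
  qed
  then show ?thesis
    unfolding incident_def using fin
    by (subst sum_multicount[of _ _ _ 2]) simp_all
qed

text \<open>Each counted vertex contributes at least \<open>d\<close> to the degree sum, which is
  twice the number of edges.\<close>

lemma card_high_degree:
  assumes "simple_graph G"
  shows "card {v \<in> verts G. d \<le> card (incident G v)} * d \<le> 2 * card (edges G)"
proof -
  have fin: "finite (verts G)" using assms by (simp add: simple_graph_def)
  have "card {v \<in> verts G. d \<le> card (incident G v)} * d
      \<le> (\<Sum>v\<in>{v \<in> verts G. d \<le> card (incident G v)}. card (incident G v))"
    by (rule sum_bounded_below[where 'a = nat, simplified]) auto
  also have "\<dots> \<le> (\<Sum>v\<in>verts G. card (incident G v))"
    by (rule sum_mono2) (auto simp: fin)
  finally show ?thesis using handshake[OF assms] by simp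
qed

lemma card_le_incident:
  assumes "simple_graph G" "\<And>w. w \<in> A \<Longrightarrow> {v, w} \<in> edges G \<and> {v, w} \<in> B"
  shows "card A \<le> card (incident G v \<inter> B)"
proof (rule card_inj_on_le)
  show "inj_on (\<lambda>w. {v, w}) A" by (auto simp: inj_on_def doubleton_eq_iff)
  show "(\<lambda>w. {v, w}) ` A \<subseteq> incident G v \<inter> B" using assms(2) by (auto simp: incident_def)
  show "finite (incident G v \<inter> B)" using finite_edges[OF assms(1)] by (simp add: incident_def)
qed

text \<open>The vertices are numbered and cut into consecutive blocks of length \<open>m\<close>.
  For \<open>m = 0\<close> the set is empty and division by \<open>m\<close> is avoided.\<close>

lemma exists_balanced_partition:
  fixes V :: "'a set"
  assumes "finite V" "card V \<le> p * m"
  obtains \<phi> where "\<And>v. v \<in> V \<Longrightarrow> \<phi> v < p" "\<And>i. card {v \<in> V. \<phi> v = i} \<le> m"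
proof (cases "m = 0")
  case True
  then have "V = {}" using assms by simp
  then show ?thesis using that[of "\<lambda>_. 0"] by simp
next
  case False
  obtain h where h: "bij_betw h V {0..<card V}"
    using ex_bij_betw_finite_nat[OF assms(1)] by blast
  show ?thesis
  proof (rule that[of "\<lambda>v. h v div m"])
    fix v assume "v \<in> V"
    then have "h v < card V" using bij_betwE[OF h] by fastforce
    then have "h v < p * m" using assms(2) by simp
    then show "h v div m < p" using False by (simp add: less_mult_imp_div_less)
  next
    fix i
    have "card {v \<in> V. h v div m = i} \<le> card {i * m..<i * m + m}"
    proof (rule card_inj_on_le)
      show "inj_on h {v \<in> V. h v div m = i}"
        using h by (auto simp: bij_betw_def inj_on_def)
      show "h ` {v \<in> V. h v div m = i} \<subseteq> {i * m..<i * m + m}"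
        using False
        by (auto simp: div_times_less_eq_dividend) (metis add.commute dividend_less_div_times not_gr_zero)
    qed auto
    then show "card {v \<in> V. h v div m = i} \<le> m" by simp
  qed
qed

text \<open>Colourings act on edges as sets; for a partition \<open>\<phi>\<close> of the vertices
  this says that an edge lies inside a part.\<close>

definition constant_on :: "('a \<Rightarrow> 'b) \<Rightarrow> 'a set \<Rightarrow> bool" where
  "constant_on \<phi> e \<longleftrightarrow> (\<forall>x\<in>e. \<forall>y\<in>e. \<phi> x = \<phi> y)"

lemma constant_on_doubleton: "constant_on \<phi> {u, v} \<longleftrightarrow> \<phi> u = \<phi> v"
  by (auto simp: constant_on_def)

lemma constant_on_fun_upd: "v \<notin> e \<Longrightarrow> constant_on (\<phi>(v := c)) e \<longleftrightarrow> constant_on \<phi> e"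
  unfolding constant_on_def by (intro ball_cong refl) (metis fun_upd_other)

text \<open>Take a partition with fewest internal edges. Moving \<open>v\<close> to any of the
  \<open>q\<close> classes leaves it with at least as many internal edges, and the edge sets so
  obtained are disjoint for different classes, so \<open>q\<close> times the present number is at
  most the degree.\<close>

lemma exists_internal_degree_partition:
  fixes G :: "'a graph"
  assumes G: "simple_graph G" and q: "0 < q"
  obtains \<phi> :: "'a \<Rightarrow> nat" where "\<And>v. \<phi> v < q"
    "\<And>v. q * card (incident G v \<inter> {e. constant_on \<phi> e}) \<le> card (incident G v)"
proof -
  let ?E = "edges G"
  define M where "M \<phi> = card (?E \<inter> {e. constant_on \<phi> e})" for \<phi> :: "'a \<Rightarrow> nat"
  have fin: "finite ?E" by (rule finite_edges[OF G])
  obtain \<phi> where \<phi>: "\<forall>v. \<phi> v < q" and min: "\<And>\<psi>. \<forall>v. \<psi> v < q \<Longrightarrow> M \<phi> \<le> M \<psi>"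
    using ex_has_least_nat[of "\<lambda>\<phi>. \<forall>v. \<phi> v < q" "\<lambda>_. 0" M] q by blast
  show ?thesis
  proof (rule that[of \<phi>])
    show "\<phi> v < q" for v using \<phi> by simp
  next
    fix v
    let ?I = "\<lambda>\<psi>. incident G v \<inter> {e. constant_on \<psi> e}"
    let ?R = "\<lambda>\<psi>. (?E - incident G v) \<inter> {e. constant_on \<psi> e}"
    have finI: "finite (incident G v)" using fin by (simp add: incident_def)
    \<comment> \<open>Internal edges are split by whether they contain \<open>v\<close>; moving
      \<open>v\<close> affects only those that do.\<close>
    have split: "M \<psi> = card (?I \<psi>) + card (?R \<psi>)" for \<psi>
    proof -
      have "?E \<inter> {e. constant_on \<psi> e} = ?I \<psi> \<union> ?R \<psi>" by (auto simp: incident_def)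
      then show ?thesis unfolding M_def
        by (simp only:) (rule card_Un_disjoint, use fin finI in auto)
    qed
    have step: "card (?I \<phi>) \<le> card (?I (\<phi>(v := c)))" if "c < q" for c
    proof -
      have "e \<in> ?R (\<phi>(v := c)) \<longleftrightarrow> e \<in> ?R \<phi>" for e
        using constant_on_fun_upd[of v e \<phi> c] by (auto simp: incident_def)
      then have "?R (\<phi>(v := c)) = ?R \<phi>" by blast
      moreover have "M \<phi> \<le> M (\<phi>(v := c))" using \<phi> that by (intro min) simp
      ultimately show ?thesis using split[of \<phi>] split[of "\<phi>(v := c)"] by simp
    qed
    have disj: "?I (\<phi>(v := c)) \<inter> ?I (\<phi>(v := c')) = {}" if "c \<noteq> c'" for c c'
    proof -
      have False if e: "e \<in> ?I (\<phi>(v := c))" "e \<in> ?I (\<phi>(v := c'))" for e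
      proof -
        have "v \<in> e" "card e = 2"
          using e G by (auto simp: incident_def simple_graph_def nsets_def)
        then obtain w where "e = {v, w}" "w \<noteq> v" by (auto simp: card_2_iff)
        then show False using e \<open>c \<noteq> c'\<close> by (auto simp: constant_on_doubleton)
      qed
      then show ?thesis by blast
    qed
    have "q * card (?I \<phi>) = (\<Sum>c<q. card (?I \<phi>))" by simp
    also have "\<dots> \<le> (\<Sum>c<q. card (?I (\<phi>(v := c))))" by (rule sum_mono) (use step in auto)
    also have "\<dots> = card (\<Union>c<q. ?I (\<phi>(v := c)))"
      by (rule card_UN_disjoint[symmetric]) (use finI disj in auto)
    also have "\<dots> \<le> card (incident G v)" by (rule card_mono) (use finI in auto)
    finally show "q * card (?I \<phi>) \<le> card (incident G v)" .
  qed
qed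

text \<open>Colour an edge by whether both ends have degree at least \<open>n\<close>. Core vertices
  have \<open>n\<close> pendant edges, so an edge between two of them fixes the colour, and then all
  \<open>k * (n + 1)\<close> vertices of the copy have degree at least \<open>n\<close>. This covers
  \<open>k = 2\<close>.\<close>

lemma ramsey_edges_double_star:
  fixes G :: "'a graph"
  assumes G: "simple_graph G" and R: "is_ramsey_for G (starburst k n)" and k: "2 \<le> k"
  shows "k * (n + 1) * n \<le> 2 * card (edges G)"
proof -
  define H where "H = {v \<in> verts G. n \<le> card (incident G v)}"
  have finH: "finite H" using G by (simp add: H_def simple_graph_def)
  obtain g \<beta> where g: "inj_on g ({..<k} \<times> {0..n})" "g ` ({..<k} \<times> {0..n}) \<subseteq> verts G"
    and core: "\<And>i j. i < k \<Longrightarrow> j < k \<Longrightarrow> i \<noteq> j \<Longrightarrow>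
       {g (i, 0), g (j, 0)} \<in> edges G \<and> ({g (i, 0), g (j, 0)} \<subseteq> H) = \<beta>"
    and leaf: "\<And>i j. i < k \<Longrightarrow> 1 \<le> j \<Longrightarrow> j \<le> n \<Longrightarrow>
       {g (i, 0), g (i, j)} \<in> edges G \<and> ({g (i, 0), g (i, j)} \<subseteq> H) = \<beta>"
    using R by (rule ramsey_starburstE[where \<chi> = "\<lambda>e. e \<subseteq> H"]) blast
  have coreH: "g (i, 0) \<in> H" if "i < k" for i
  proof -
    have "inj_on (\<lambda>j. g (i, j)) {1..n}"
      using g(1) that by (auto simp: inj_on_def)
    then have "n = card ((\<lambda>j. g (i, j)) ` {1..n})" by (simp add: card_image)
    also have "\<dots> \<le> card (incident G (g (i, 0)) \<inter> UNIV)"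
      by (rule card_le_incident[OF G]) (use leaf[OF that] in auto)
    finally show ?thesis using g(2) that by (auto simp: H_def)
  qed
  have \<beta> using core[of 0 1] coreH[of 0] coreH[of 1] k by auto
  have "g (i, j) \<in> H" if "i < k" "j \<le> n" for i j
    using leaf[of i j] coreH[of i] that \<open>\<beta>\<close> by (cases "j = 0") simp_all
  then have "g ` ({..<k} \<times> {0..n}) \<subseteq> H" by auto
  then have "k * (n + 1) \<le> card H"
    using card_inj_on_le[OF g(1) _ finH] by simp
  then show ?thesis
    using card_high_degree[OF G, of n] unfolding H_def
    by (meson le_trans mult_le_mono1)
qed

lemma ramsey_edges_partition:
  fixes G :: "'a graph"
  assumes G: "simple_graph G" and R: "is_ramsey_for G (starburst k n)"
    and pq: "p + q < k" and q: "0 < q" and n: "0 < n"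
  shows "p * (k * n) * (q * n) \<le> 2 * card (edges G)"
proof -
  define H where "H = {v \<in> verts G. q * n \<le> card (incident G v)}"
  have finH: "finite H" using G by (simp add: H_def simple_graph_def)
  have "p * (k * n) < card H"
  proof (rule ccontr)
    assume "\<not> p * (k * n) < card H"
    then have "card H \<le> p * (k * n)" by simp
    with finH obtain \<phi> where \<phi>: "\<And>v. v \<in> H \<Longrightarrow> \<phi> v < p" "\<And>i. card {v \<in> H. \<phi> v = i} \<le> k * n"
      by (rule exists_balanced_partition) blast
    obtain \<psi> :: "'a \<Rightarrow> nat" where \<psi>: "\<And>v. \<psi> v < q"
      "\<And>v. q * card (incident G v \<inter> {e. constant_on \<psi> e}) \<le> card (incident G v)"
      using exists_internal_degree_partition[OF G q] by blast
    \<comment> \<open>The parts of \<open>H\<close> get the labels below \<open>p\<close>, the parts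
      of the other vertices the labels from \<open>p\<close> up to \<open>p + q - 1\<close>.\<close>
    define \<theta> where "\<theta> v = (if v \<in> H then \<phi> v else p + \<psi> v)" for v
    obtain g \<beta> where g: "inj_on g ({..<k} \<times> {0..n})" "g ` ({..<k} \<times> {0..n}) \<subseteq> verts G"
      and core: "\<And>i j. i < k \<Longrightarrow> j < k \<Longrightarrow> i \<noteq> j \<Longrightarrow>
         {g (i, 0), g (j, 0)} \<in> edges G \<and> constant_on \<theta> {g (i, 0), g (j, 0)} = \<beta>"
      and leaf: "\<And>i j. i < k \<Longrightarrow> 1 \<le> j \<Longrightarrow> j \<le> n \<Longrightarrow>
         {g (i, 0), g (i, j)} \<in> edges G \<and> constant_on \<theta> {g (i, 0), g (i, j)} = \<beta>"
      using R by (rule ramsey_starburstE[where \<chi> = "constant_on \<theta>"]) blast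
    have \<theta>_less: "\<theta> v < p + q" for v
      using \<phi>(1) \<psi>(1)[of v] by (auto simp: \<theta>_def trans_less_add1)
    \<comment> \<open>In the colour of the edges between parts, the \<open>k\<close> core vertices
      would need \<open>k\<close> distinct labels, but there are only
      \<open>p + q < k\<close>.\<close>
    have \<beta>
    proof (rule ccontr)
      assume "\<not> \<beta>"
      then have "inj_on (\<lambda>i. \<theta> (g (i, 0))) {..<k}"
        using core by (auto simp: inj_on_def constant_on_doubleton)
      then have "card {..<k} \<le> card {..<p + q}"
        by (rule card_inj_on_le) (use \<theta>_less in auto)
      with pq show False by simp
    qed
    have k: "0 < k" using pq by simp
    define t where "t = \<theta> (g (0, 0))"
    have core_t: "\<theta> (g (i, 0)) = t" if "i < k" for i
      using core[OF that k] \<open>\<beta>\<close> by (cases "i = 0") (auto simp: t_def constant_on_doubleton)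
    have all_t: "\<theta> (g (i, j)) = t" if "i < k" "j \<le> n" for i j
      using leaf[of i j] core_t that \<open>\<beta>\<close> by (cases "j = 0") (auto simp: constant_on_doubleton)
    show False
    proof (cases "t < p")
      \<comment> \<open>A copy inside a part of \<open>H\<close> does not fit: it has
        \<open>k * (n + 1)\<close> vertices and the part at most \<open>k * n\<close>.\<close>
      case True
      have "g ` ({..<k} \<times> {0..n}) \<subseteq> {v \<in> H. \<phi> v = t}"
        using all_t True by (fastforce simp: \<theta>_def split: if_splits)
      then have "k * (n + 1) \<le> card {v \<in> H. \<phi> v = t}"
        using card_inj_on_le[OF g(1)] finH by fastforce
      with \<phi>(2)[of t] k show False by simp
    next
      \<comment> \<open>Inside a part of low-degree vertices, a core vertex has \<open>n\<close>
        internal neighbours, which forces degree at least \<open>q * n\<close> and contradicts its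
        absence from \<open>H\<close>.\<close>
      case False
      let ?v = "g (0, 0)"
      have vG: "?v \<in> verts G" using g(2) k by (intro subsetD[OF g(2)] imageI) simp
      have "?v \<notin> H" using \<phi>(1) False unfolding t_def \<theta>_def by metis
      then have deg: "card (incident G ?v) < q * n"
        using vG by (auto simp: H_def)
      have notH: "g (0, j) \<notin> H" if "j \<le> n" for j
        using \<phi>(1) False all_t[OF k that] unfolding \<theta>_def by metis
      have "inj_on (\<lambda>j. g (0, j)) {1..n}"
        using g(1) k by (auto simp: inj_on_def)
      then have "n = card ((\<lambda>j. g (0, j)) ` {1..n})" by (simp add: card_image)
      also have "\<dots> \<le> card (incident G ?v \<inter> {e. constant_on \<psi> e})"
      proof (rule card_le_incident[OF G])
        fix w assume "w \<in> (\<lambda>j. g (0, j)) ` {1..n}"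
        then obtain j where j: "1 \<le> j" "j \<le> n" "w = g (0, j)" by auto
        have "\<psi> w = \<psi> ?v"
          using all_t[OF k j(2)] all_t[OF k, of 0] notH[OF j(2)] notH[of 0] j(3)
          by (simp add: \<theta>_def)
        then show "{?v, w} \<in> edges G \<and> {?v, w} \<in> {e. constant_on \<psi> e}"
          using leaf[OF k j(1,2)] j(3) by (simp add: constant_on_doubleton)
      qed
      finally have "q * n \<le> q * card (incident G ?v \<inter> {e. constant_on \<psi> e})" by simp
      with \<psi>(2)[of ?v] deg show False by linarith
    qed
  qed
  then show ?thesis
    using card_high_degree[OF G, of "q * n"] unfolding H_def
    by (meson le_trans less_imp_le mult_le_mono1)
qed

lemma ramsey_edges_lower_bound:
  fixes G :: "'a graph"
  assumes G: "simple_graph G" and R: "is_ramsey_for G (starburst k n)" and k: "2 \<le> k"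
  shows "real k ^ 3 * real n ^ 2 / 72 \<le> real (card (edges G))"
proof (cases "k = 2 \<or> n = 0")
  \<comment> \<open>For \<open>k = 2\<close> the choice of \<open>q\<close> below would give
    0.\<close>
  case True
  have "real (k * (n + 1) * n) \<le> real (2 * card (edges G))"
    using ramsey_edges_double_star[OF G R k] by (rule of_nat_mono)
  then have "real k * real n ^ 2 + real k * real n \<le> 2 * real (card (edges G))"
    by (simp add: power2_eq_square algebra_simps)
  with True show ?thesis by auto
next
  case False
  define q where "q = (k - 1) div 2"
  define p where "p = k - 1 - q"
  have pq: "p + q < k" "0 < q" and n: "0 < n"
    using False k unfolding p_def q_def by linarith+
  have "real (p * (k * n) * (q * n)) \<le> real (2 * card (edges G))"
    by (intro of_nat_mono ramsey_edges_partition[OF G R pq n])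
  \<comment> \<open>The bounds \<open>k / 6\<close> use \<open>k \<ge> 3\<close>. Together with the
    factor 2 of the degree sum they give the constant \<open>72 = 2 * 6 * 6\<close>.\<close>
  moreover have "real k / 6 \<le> real p" "real k / 6 \<le> real q"
    using False k unfolding p_def q_def by linarith+
  then have "(real k / 6) * (real k / 6) * (real k * real n ^ 2)
      \<le> real p * real q * (real k * real n ^ 2)"
    by (intro mult_right_mono mult_mono) auto
  ultimately show ?thesis by (simp add: power2_eq_square power3_eq_cube mult_ac)
qed

section \<open>Orthogonal arrays\<close>

lemma sum_fibres:
  fixes f :: "'a \<Rightarrow> nat" and h :: "'a \<Rightarrow> 'b::comm_monoid_add"
  assumes "finite A" "\<And>x. x \<in> A \<Longrightarrow> f x < q"
  shows "(\<Sum>c<q. \<Sum>x | x \<in> A \<and> f x = c. h x) = (\<Sum>x\<in>A. h x)"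
  by (rule sum.group) (use assms in auto)

lemma card_fibres:
  fixes f :: "'a \<Rightarrow> nat"
  assumes "finite A" "\<And>x. x \<in> A \<Longrightarrow> f x < q"
  shows "(\<Sum>c<q. card {x \<in> A. f x = c}) = card A"
  using sum_fibres[OF assms, where h = "\<lambda>_. 1 :: nat"] by simp

lemma card_Collect_real: "finite A \<Longrightarrow> real (card {x \<in> A. P x}) = (\<Sum>x\<in>A. of_bool (P x))"
  by (simp add: Int_def)

text \<open>Turan's theorem in counting form, for a reflexive relation without independent sets of
  size \<open>m + 1\<close>. Induction on \<open>m\<close>: remove the closed neighbourhood
  \<open>N\<close> of a vertex \<open>v\<close> of least degree. Independent sets in the rest can be
  enlarged by \<open>v\<close>, so they are smaller by one, and the vertices of \<open>N\<close>
  contribute at least the square of that degree.\<close>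

lemma turan_square:
  fixes E :: "'a \<Rightarrow> 'a \<Rightarrow> bool"
  assumes "finite U" and "\<And>u v. E u v \<Longrightarrow> E v u" and "\<And>u. u \<in> U \<Longrightarrow> E u u"
    and "\<And>I. I \<subseteq> U \<Longrightarrow> card I = Suc m \<Longrightarrow> \<exists>u\<in>I. \<exists>v\<in>I. u \<noteq> v \<and> E u v"
  shows "real (card U) ^ 2 \<le> real m * (\<Sum>u\<in>U. real (card {w \<in> U. E u w}))"
  using assms(1,3,4)
proof (induction m arbitrary: U)
  case 0
  have "U = {}"
  proof (rule ccontr)
    assume "U \<noteq> {}"
    then obtain u where "u \<in> U" by blast
    with "0.prems"(3)[of "{u}"] show False by auto
  qed
  then show ?case by simp
next
  case (Suc m)
  define d where "d u = card {w \<in> U. E u w}" for u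
  show ?case
  proof (cases "U = {}")
    case False
    then obtain v where v: "v \<in> U" "\<And>u. u \<in> U \<Longrightarrow> d v \<le> d u"
      using ex_has_least_nat[of "\<lambda>u. u \<in> U" _ d] by blast
    define N where "N = {w \<in> U. E v w}"
    define P where "P = (\<Sum>u\<in>U - N. real (card {w \<in> U - N. E u w}))"
    have fin: "finite N" "N \<subseteq> U" "card N = d v"
      using Suc.prems(1) by (auto simp: N_def d_def)
    have IH: "real (card (U - N)) ^ 2 \<le> real m * P"
      unfolding P_def
    proof (rule Suc.IH)
      fix I assume I: "I \<subseteq> U - N" "card I = Suc m"
      then have "finite I" by (intro card_ge_0_finite) simp
      have "v \<notin> I" using I v(1) Suc.prems(2) by (auto simp: N_def)
      then have "card (insert v I) = Suc (Suc m)" using I \<open>finite I\<close> by simp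
      moreover have "insert v I \<subseteq> U" using I v(1) by auto
      ultimately obtain x y where xy: "x \<in> insert v I" "y \<in> insert v I" "x \<noteq> y" "E x y"
        using Suc.prems(3) by metis
      have "\<not> E v w" if "w \<in> I" for w using I that by (auto simp: N_def)
      then show "\<exists>u\<in>I. \<exists>v\<in>I. u \<noteq> v \<and> E u v" using xy assms(2) by (metis insertE)
    qed (use Suc.prems in auto)
    have "(\<Sum>u\<in>U. real (d u)) = (\<Sum>u\<in>U - N. real (d u)) + (\<Sum>u\<in>N. real (d u))"
      using Suc.prems(1) fin by (intro sum.subset_diff) auto
    moreover have "P \<le> (\<Sum>u\<in>U - N. real (d u))"
      unfolding P_def d_def using Suc.prems(1)
      by (intro sum_mono of_nat_mono card_mono) auto
    moreover have "real (d v) * real (d v) \<le> (\<Sum>u\<in>N. real (d u))"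
      using sum_mono[of N "\<lambda>_. real (d v)" "\<lambda>u. real (d u)"] v(2) fin by (auto simp: N_def)
    ultimately have sum: "P + real (d v) ^ 2 \<le> (\<Sum>u\<in>U. real (d u))"
      by (simp add: power2_eq_square)
    let ?x = "real (card (U - N))" and ?y = "real (d v)"
    have P0: "0 \<le> P" by (simp add: P_def sum_nonneg)
    \<comment> \<open>The cross term in the square of \<open>?x + ?y\<close>. It is bounded by
      expanding \<open>(?x - m * ?y) ^ 2 \<ge> 0\<close> and dividing by \<open>m\<close>; for
      \<open>m = 0\<close> the induction hypothesis gives \<open>?x = 0\<close>.\<close>
    have "2 * ?x * ?y \<le> P + real m * ?y ^ 2"
    proof (cases "m = 0")
      case True
      then show ?thesis using IH P0 by simp
    next
      case False
      have "0 \<le> (?x - real m * ?y) ^ 2" by simp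
      then have "real m * (2 * ?x * ?y) \<le> ?x ^ 2 + real m * (real m * ?y ^ 2)"
        by (simp add: power2_eq_square algebra_simps)
      also have "\<dots> \<le> real m * (P + real m * ?y ^ 2)"
        using IH by (simp add: algebra_simps)
      finally show ?thesis using False by simp
    qed
    moreover have "real (card U) = ?x + ?y"
      using fin Suc.prems(1) by (metis card_Diff_subset card_mono le_add_diff_inverse2 of_nat_add)
    ultimately have "real (card U) ^ 2 \<le> real (Suc m) * (P + ?y ^ 2)"
      using IH by (simp add: power2_sum algebra_simps)
    also have "\<dots> \<le> real (Suc m) * (\<Sum>u\<in>U. real (d u))"
      using sum by (intro mult_left_mono) auto
    finally show ?thesis by (simp add: d_def)
  qed simp
qed

text \<open>The blow-up, by a factor of \<open>b\<close>, of \<open>r\<close> parallel classes of lines of an affine plane of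
  order \<open>q\<close>: the line of class \<open>m\<close> through \<open>v\<close> is given by the value \<open>L m v\<close>.\<close>

locale orthogonal_array =
  fixes V :: "'a set" and L :: "nat \<Rightarrow> 'a \<Rightarrow> nat" and r q b :: nat
  assumes finite_V: "finite V" and columns: "2 \<le> r" and levels: "0 < q"
    and L_less: "m < r \<Longrightarrow> v \<in> V \<Longrightarrow> L m v < q"
    and card_cell: "m < r \<Longrightarrow> m' < r \<Longrightarrow> m \<noteq> m' \<Longrightarrow> c < q \<Longrightarrow> c' < q \<Longrightarrow>
      card {v \<in> V. L m v = c \<and> L m' v = c'} = b"
    and twins: "u \<in> V \<Longrightarrow> v \<in> V \<Longrightarrow> m < r \<Longrightarrow> m' < r \<Longrightarrow> m \<noteq> m' \<Longrightarrow> L m u = L m v \<Longrightarrow>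
      L m' u = L m' v \<Longrightarrow> i < r \<Longrightarrow> L i u = L i v"
begin

text \<open>The number of chosen lines through both \<open>u\<close> and \<open>v\<close>:
  \<open>r\<close> for copies of the same point, otherwise 0 or 1.\<close>

definition agr :: "'a \<Rightarrow> 'a \<Rightarrow> real" where
  "agr u v = (\<Sum>m<r. of_bool (L m u = L m v))"

text \<open>In the blow-up, the twins of \<open>u\<close> are the copies of its point,
  \<open>u\<close> included.\<close>

definition twin :: "'a \<Rightarrow> 'a \<Rightarrow> bool" where
  "twin u v \<longleftrightarrow> (\<forall>m<r. L m u = L m v)"

text \<open>Replaces the number of neighbours of \<open>u\<close> in \<open>W\<close>, which it
  bounds from above, because its moments over \<open>u\<close> can be computed class by
  class.\<close>

definition weight :: "'a \<Rightarrow> 'a set \<Rightarrow> real" where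
  "weight u W = (\<Sum>w\<in>W. agr u w)"

section \<open>Agreement counts and their first two moments\<close>

lemma agr_commute: "agr u v = agr v u"
  by (simp add: agr_def eq_commute)

lemma agr_nonneg: "0 \<le> agr u v"
  by (simp add: agr_def sum_nonneg)

lemma twin_refl: "twin u u" and twin_sym: "twin u v \<Longrightarrow> twin v u"
  by (simp_all add: twin_def)

lemma other_column:
  assumes "m < r"
  obtains m' where "m' < r" "m' \<noteq> m"
  using columns by (intro that[of "if m = 0 then 1 else 0"]) auto

lemma card_line:
  assumes "m < r" "c < q"
  shows "card {v \<in> V. L m v = c} = q * b"
proof -
  obtain m' where m': "m' < r" "m' \<noteq> m" using other_column[OF assms(1)] .
  have "card {v \<in> V. L m v = c} = (\<Sum>c'<q. card {x \<in> {v \<in> V. L m v = c}. L m' x = c'})"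
    by (rule card_fibres[symmetric]) (use finite_V L_less m' in auto)
  also have "\<dots> = (\<Sum>c'<q. b)"
    by (rule sum.cong) (use card_cell[OF assms(1) m'(1) m'(2)[symmetric] assms(2)] in auto)
  finally show ?thesis by simp
qed

lemma card_V: "card V = q * q * b"
proof -
  have "card V = (\<Sum>c<q. card {x \<in> V. L 0 x = c})"
    by (rule card_fibres[symmetric]) (use finite_V L_less columns in auto)
  also have "\<dots> = (\<Sum>c<q. q * b)"
    using card_line[of 0] columns by (intro sum.cong) auto
  finally show ?thesis by simp
qed

text \<open>By \<open>twins\<close>, agreement in classes 0 and 1 implies agreement in all, so the
  copies of a point form one cell.\<close>

lemma card_twin:
  assumes "u \<in> V"
  shows "card {v \<in> V. twin u v} = b"
proof -
  have r: "0 < r" "1 < r" using columns by auto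
  have "twin u v \<longleftrightarrow> L 0 v = L 0 u \<and> L 1 v = L 1 u" if "v \<in> V" for v
  proof
    show "twin u v \<Longrightarrow> L 0 v = L 0 u \<and> L 1 v = L 1 u"
      using r by (simp add: twin_def)
    show "L 0 v = L 0 u \<and> L 1 v = L 1 u \<Longrightarrow> twin u v"
      using twins[OF assms that r] by (simp add: twin_def)
  qed
  then have "{v \<in> V. twin u v} = {v \<in> V. L 0 v = L 0 u \<and> L 1 v = L 1 u}" by blast
  then show ?thesis using card_cell[OF r] L_less[OF r(1) assms] L_less[OF r(2) assms] by simp
qed

lemma agr_le_1:
  assumes "u \<in> V" "v \<in> V" "\<not> twin u v"
  shows "agr u v \<le> 1"
proof -
  have "agr u v = real (card {m \<in> {..<r}. L m u = L m v})"
    unfolding agr_def by (rule card_Collect_real[symmetric]) simp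
  moreover have "card {m \<in> {..<r}. L m u = L m v} \<le> Suc 0"
    using twins[OF assms(1,2)] assms(3)
    by (subst card_le_Suc0_iff_eq) (auto simp: twin_def)
  ultimately show ?thesis by simp
qed

lemma agr_twin: "twin u v \<Longrightarrow> agr u v = real r"
  by (simp add: agr_def twin_def)

lemma agr_le:
  assumes "u \<in> V" "v \<in> V"
  shows "agr u v \<le> 1 + real r * of_bool (twin u v)"
  using agr_le_1[OF assms] agr_twin by (cases "twin u v") auto

lemma sum_agr:
  assumes "w \<in> V"
  shows "(\<Sum>u\<in>V. agr u w) = real (r * q * b)"
proof -
  have "(\<Sum>u\<in>V. agr u w) = (\<Sum>m<r. \<Sum>u\<in>V. of_bool (L m u = L m w))"
    unfolding agr_def by (rule sum.swap)
  also have "\<dots> = (\<Sum>m<r. real (q * b))"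
  proof (rule sum.cong)
    fix m assume "m \<in> {..<r}"
    then show "(\<Sum>u\<in>V. of_bool (L m u = L m w)) = real (q * b)"
      using card_line[of m "L m w"] L_less assms
      by (simp only: card_Collect_real[OF finite_V, symmetric]) auto
  qed simp
  finally show ?thesis by simp
qed

text \<open>Expand over pairs of classes. Two different classes give a cell of \<open>b\<close>
  points; the same class twice gives a whole line of \<open>q * b\<close> points if \<open>w\<close>
  and \<open>w'\<close> agree there, and nothing otherwise.\<close>

lemma sum_agr_mult:
  assumes "w \<in> V" "w' \<in> V"
  shows "(\<Sum>u\<in>V. agr u w * agr u w') \<le> real r ^ 2 * real b + real (q * b) * agr w w'"
proof -
  have cell: "(\<Sum>u\<in>V. of_bool (L m u = L m w) * of_bool (L m' u = L m' w'))
      \<le> real b + of_bool (m = m') * (real (q * b) * of_bool (L m w = L m w'))"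
    if "m < r" "m' < r" for m m'
  proof -
    have "(\<Sum>u\<in>V. of_bool (L m u = L m w) * of_bool (L m' u = L m' w'))
        = (\<Sum>u\<in>V. of_bool (L m u = L m w \<and> L m' u = L m' w') :: real)"
      by (rule sum.cong) auto
    also have "\<dots> = real (card {u \<in> V. L m u = L m w \<and> L m' u = L m' w'})"
      by (rule card_Collect_real[OF finite_V, symmetric])
    also have "\<dots> \<le> real b + of_bool (m = m') * (real (q * b) * of_bool (L m w = L m w'))"
    proof (cases "m = m'")
      case True
      show ?thesis
      proof (cases "L m w = L m w'")
        case True
        have "card {u \<in> V. L m u = L m w \<and> L m' u = L m' w'} = q * b"
          using card_line[of m "L m w"] True \<open>m = m'\<close> that L_less assms by auto
        then show ?thesis using True \<open>m = m'\<close> by simp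
      next
        case False
        then have "{u \<in> V. L m u = L m w \<and> L m' u = L m' w'} = {}" using \<open>m = m'\<close> by auto
        then show ?thesis by (simp only: card.empty) simp
      qed
    next
      case False
      then show ?thesis using card_cell[OF that] L_less that assms by simp
    qed
    finally show ?thesis .
  qed
  have "(\<Sum>u\<in>V. agr u w * agr u w')
      = (\<Sum>u\<in>V. \<Sum>m<r. \<Sum>m'<r. of_bool (L m u = L m w) * of_bool (L m' u = L m' w'))"
    unfolding agr_def by (simp only: sum_product)
  also have "\<dots> = (\<Sum>m<r. \<Sum>m'<r. \<Sum>u\<in>V. of_bool (L m u = L m w) * of_bool (L m' u = L m' w'))"
    by (subst sum.swap, rule sum.cong[OF refl], rule sum.swap)
  also have "\<dots> \<le> (\<Sum>m<r. \<Sum>m'<r.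
      real b + of_bool (m = m') * (real (q * b) * of_bool (L m w = L m w')))"
    by (intro sum_mono cell) auto
  also have "\<dots> = (\<Sum>m<r. real r * real b + real (q * b) * of_bool (L m w = L m w'))"
    by (intro sum.cong refl) (simp add: sum.distrib sum.delta of_bool_def if_distrib[of "\<lambda>x. x * _"] cong: if_cong)
  also have "\<dots> = real r ^ 2 * real b + real (q * b) * agr w w'"
    by (simp add: sum.distrib agr_def sum_distrib_left power2_eq_square)
  finally show ?thesis .
qed

text \<open>A pair that is not a twin pair contributes at most 1, and each \<open>u\<close> has at
  most \<open>b\<close> twins, each adding at most \<open>r\<close> more.\<close>

lemma sum_agr_subset:
  assumes "W \<subseteq> V"
  shows "(\<Sum>u\<in>W. \<Sum>w\<in>W. agr u w) \<le> real (card W) ^ 2 + real r * real b * real (card W)"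
proof -
  have finW: "finite W" using assms finite_V finite_subset by blast
  have "(\<Sum>w\<in>W. agr u w) \<le> real (card W) + real r * real b" if "u \<in> W" for u
  proof -
    have u: "u \<in> V" using that assms by blast
    have "(\<Sum>w\<in>W. agr u w) \<le> (\<Sum>w\<in>W. 1 + real r * of_bool (twin u w))"
      by (rule sum_mono) (use agr_le u assms in blast)
    also have "\<dots> = real (card W) + real r * real (card {w \<in> W. twin u w})"
      by (simp only: sum.distrib sum_distrib_left[symmetric] card_Collect_real[OF finW]) simp
    also have "card {w \<in> W. twin u w} \<le> b"
      unfolding card_twin[OF u, symmetric] by (rule card_mono) (use finite_V assms in auto)
    finally show ?thesis by (simp add: mult_left_mono)
  qed
  then have "(\<Sum>u\<in>W. \<Sum>w\<in>W. agr u w) \<le> (\<Sum>u\<in>W. real (card W) + real r * real b)"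
    by (rule sum_mono)
  then show ?thesis by (simp add: power2_eq_square algebra_simps)
qed

text \<open>\<open>\<mu>\<close> is the mean of the weight over \<open>V\<close>: the total
  \<open>card W * r * q * b\<close> is spread over \<open>q * q * b\<close> vertices.\<close>

lemma weight_variance:
  assumes "W \<subseteq> V"
  defines "\<mu> \<equiv> real r / real q * real (card W)"
  shows "(\<Sum>u\<in>V. (weight u W - \<mu>) ^ 2)
    \<le> real (q * b) * (real (card W) ^ 2 + real r * real b * real (card W))"
proof -
  have first: "(\<Sum>u\<in>V. weight u W) = real (card W) * real (r * q * b)"
  proof -
    have "(\<Sum>u\<in>V. weight u W) = (\<Sum>w\<in>W. \<Sum>u\<in>V. agr u w)"
      unfolding weight_def by (rule sum.swap)
    also have "\<dots> = (\<Sum>w\<in>W. real (r * q * b))"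
      by (rule sum.cong) (use sum_agr assms in auto)
    finally show ?thesis by simp
  qed
  have "(\<Sum>u\<in>V. weight u W ^ 2) = (\<Sum>u\<in>V. \<Sum>w\<in>W. \<Sum>w'\<in>W. agr u w * agr u w')"
    unfolding weight_def by (simp only: power2_eq_square sum_product)
  also have "\<dots> = (\<Sum>w\<in>W. \<Sum>w'\<in>W. \<Sum>u\<in>V. agr u w * agr u w')"
    by (subst sum.swap, rule sum.cong[OF refl], rule sum.swap)
  also have "\<dots> \<le> (\<Sum>w\<in>W. \<Sum>w'\<in>W. real r ^ 2 * real b + real (q * b) * agr w w')"
    by (intro sum_mono sum_agr_mult) (use assms in auto)
  also have "\<dots> = real (card W) ^ 2 * (real r ^ 2 * real b)
      + real (q * b) * (\<Sum>w\<in>W. \<Sum>w'\<in>W. agr w w')"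
    by (simp add: sum.distrib sum_distrib_left power2_eq_square)
  also have "\<dots> \<le> real (card W) ^ 2 * (real r ^ 2 * real b)
      + real (q * b) * (real (card W) ^ 2 + real r * real b * real (card W))"
    by (intro add_left_mono mult_left_mono sum_agr_subset assms) simp
  finally have second: "(\<Sum>u\<in>V. weight u W ^ 2) \<le> real (card W) ^ 2 * (real r ^ 2 * real b)
      + real (q * b) * (real (card W) ^ 2 + real r * real b * real (card W))" .
  have "(\<Sum>u\<in>V. (weight u W - \<mu>) ^ 2)
      = (\<Sum>u\<in>V. weight u W ^ 2) - 2 * \<mu> * (\<Sum>u\<in>V. weight u W) + real (card V) * \<mu> ^ 2"
    by (simp add: power2_diff sum.distrib sum_subtractf sum_distrib_left algebra_simps)
  \<comment> \<open>The two mean terms combine to exactly the main term of the second moment, so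
    only the contribution of agreements within \<open>W\<close> survives.\<close>
  also have "\<dots> = (\<Sum>u\<in>V. weight u W ^ 2) - real (card W) ^ 2 * (real r ^ 2 * real b)"
    using levels by (simp add: first card_V \<mu>_def power2_eq_square field_simps)
  finally show ?thesis using second by simp
qed

text \<open>Chebyshev's inequality: a counted vertex exceeds the mean \<open>\<mu>\<close> by more
  than \<open>\<mu>\<close>. The assumption \<open>r * b \<le> card W\<close> makes the twin term of
  the variance at most \<open>card W ^ 2\<close>.\<close>

lemma card_heavy:
  assumes W: "W \<subseteq> V" "r * b \<le> card W" "W \<noteq> {}"
  shows "real (card {u \<in> V. 2 * (real r / real q) * real (card W) < weight u W}) * real r ^ 2
    \<le> 2 * real q ^ 3 * real b"
proof -
  let ?B = "{u \<in> V. 2 * (real r / real q) * real (card W) < weight u W}"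
  define \<mu> where "\<mu> = real r / real q * real (card W)"
  have W0: "0 < card W" using W finite_V finite_subset by (metis card_gt_0_iff)
  have \<mu>: "0 \<le> \<mu>" by (simp add: \<mu>_def)
  have "real (card ?B) * \<mu> ^ 2 = (\<Sum>u\<in>?B. \<mu> ^ 2)" by simp
  also have "\<dots> \<le> (\<Sum>u\<in>?B. (weight u W - \<mu>) ^ 2)"
    by (intro sum_mono power_mono \<mu>) (auto simp: \<mu>_def)
  also have "\<dots> \<le> (\<Sum>u\<in>V. (weight u W - \<mu>) ^ 2)"
    by (rule sum_mono2) (auto simp: finite_V)
  also have "\<dots> \<le> real (q * b) * (real (card W) ^ 2 + real (r * b) * real (card W))"
    using weight_variance[OF W(1)] by (simp add: \<mu>_def)
  also have "\<dots> \<le> real (q * b) * (real (card W) ^ 2 + real (card W) * real (card W))"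
    using W(2) by (intro mult_left_mono add_left_mono mult_right_mono of_nat_mono) auto
  finally have "real (card ?B) * real r ^ 2 * real (card W) ^ 2
      \<le> 2 * real q ^ 3 * real b * real (card W) ^ 2"
    using levels by (simp add: \<mu>_def power2_eq_square power3_eq_cube field_simps)
  then show ?thesis using W0 by simp
qed

text \<open>Turan's bound on every line, Cauchy-Schwarz over the \<open>q\<close> lines of a class,
  and summation over the \<open>r\<close> classes. A pair is counted once for every line containing
  it, hence only once unless it is a twin pair.\<close>

lemma turan_lines:
  assumes U: "U \<subseteq> V" and sym: "\<And>u v. E u v \<Longrightarrow> E v u"
    and indep: "\<And>m c I. m < r \<Longrightarrow> I \<subseteq> {u \<in> U. L m u = c} \<Longrightarrow> card I = Suc s \<Longrightarrow>
      \<exists>u\<in>I. \<exists>v\<in>I. u \<noteq> v \<and> (E u v \<or> twin u v)"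
  shows "real r / real q * real (card U) ^ 2
    \<le> real s * (real r * real b * real (card U)
        + (\<Sum>u\<in>U. real (card {v \<in> U. E u v \<and> \<not> twin u v})))"
proof -
  have finU: "finite U" using U finite_V finite_subset by blast
  let ?U = "\<lambda>m c. {u \<in> U. L m u = c}"
  \<comment> \<open>Adjoining the twin relation provides the reflexivity that
    \<open>turan_square\<close> needs; it costs at most \<open>b\<close> pairs per vertex.\<close>
  let ?A = "\<lambda>u v. E u v \<or> twin u v"
  have cauchy: "real (card U) ^ 2 \<le> real q * (\<Sum>c<q. real (card (?U m c)) ^ 2)" if "m < r" for m
  proof -
    have "card U = (\<Sum>c<q. card (?U m c))"
      by (rule card_fibres[symmetric]) (use finU L_less that U in auto)
    then have "real (card U) = (\<Sum>c<q. real (card (?U m c)))" by simp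
    then show ?thesis
      using sum_squared_le_sum_of_squares[of "\<lambda>c. real (card (?U m c))" "{..<q}"]
      by (simp add: mult.commute)
  qed
  have line: "real (card (?U m c)) ^ 2
      \<le> real s * (\<Sum>u\<in>?U m c. \<Sum>w\<in>U. of_bool (L m u = L m w) * of_bool (?A u w))"
    if "m < r" for m c
  proof -
    have "real (card (?U m c)) ^ 2 \<le> real s * (\<Sum>u\<in>?U m c. real (card {w \<in> ?U m c. ?A u w}))"
      by (rule turan_square) (use finU sym twin_sym twin_refl indep that in \<open>auto simp del: ex_simps\<close>)
    also have "(\<Sum>u\<in>?U m c. real (card {w \<in> ?U m c. ?A u w}))
        = (\<Sum>u\<in>?U m c. \<Sum>w\<in>U. of_bool (L m u = L m w) * of_bool (?A u w))"
    proof (rule sum.cong)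
      fix u assume u: "u \<in> ?U m c"
      then have "{w \<in> ?U m c. ?A u w} = {w \<in> U. L m u = L m w \<and> ?A u w}" by auto
      then show "real (card {w \<in> ?U m c. ?A u w})
          = (\<Sum>w\<in>U. of_bool (L m u = L m w) * of_bool (?A u w))"
        by (simp only: card_Collect_real[OF finU] of_bool_conj)
    qed simp
    finally show ?thesis .
  qed
  have "real r * real (card U) ^ 2 = (\<Sum>m<r. real (card U) ^ 2)" by simp
  also have "\<dots> \<le> (\<Sum>m<r. real q * (\<Sum>c<q. real s *
      (\<Sum>u\<in>?U m c. \<Sum>w\<in>U. of_bool (L m u = L m w) * of_bool (?A u w))))"
  proof (rule sum_mono)
    fix m assume m: "m \<in> {..<r}"
    have "real (card U) ^ 2 \<le> real q * (\<Sum>c<q. real (card (?U m c)) ^ 2)"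
      using cauchy m by simp
    also have "\<dots> \<le> real q * (\<Sum>c<q. real s *
        (\<Sum>u\<in>?U m c. \<Sum>w\<in>U. of_bool (L m u = L m w) * of_bool (?A u w)))"
      by (intro mult_left_mono sum_mono line) (use m in auto)
    finally show "real (card U) ^ 2 \<le> real q * (\<Sum>c<q. real s *
        (\<Sum>u\<in>?U m c. \<Sum>w\<in>U. of_bool (L m u = L m w) * of_bool (?A u w)))" .
  qed
  also have "\<dots> = real q * real s *
      (\<Sum>m<r. \<Sum>c<q. \<Sum>u\<in>?U m c. \<Sum>w\<in>U. of_bool (L m u = L m w) * of_bool (?A u w))"
    by (simp only: sum_distrib_left mult.assoc)
  also have "(\<Sum>m<r. \<Sum>c<q. \<Sum>u\<in>?U m c. \<Sum>w\<in>U. of_bool (L m u = L m w) * of_bool (?A u w))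
      = (\<Sum>m<r. \<Sum>u\<in>U. \<Sum>w\<in>U. of_bool (L m u = L m w) * of_bool (?A u w) :: real)"
    by (intro sum.cong refl sum_fibres) (use finU L_less U in auto)
  \<comment> \<open>Exchanging the sums collects, for each pair, the number of lines through
    it.\<close>
  also have "\<dots> = (\<Sum>u\<in>U. \<Sum>w\<in>U. agr u w * of_bool (?A u w))"
    unfolding agr_def sum_distrib_right
    by (subst sum.swap, rule sum.cong[OF refl], rule sum.swap)
  also have "\<dots> \<le> (\<Sum>u\<in>U. real r * real b + real (card {v \<in> U. E u v \<and> \<not> twin u v}))"
  proof (rule sum_mono)
    fix u assume u: "u \<in> U"
    have "(\<Sum>w\<in>U. agr u w * of_bool (?A u w))
        \<le> (\<Sum>w\<in>U. real r * of_bool (twin u w) + of_bool (E u w \<and> \<not> twin u w))"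
    proof (rule sum_mono)
      fix w assume "w \<in> U"
      then show "agr u w * of_bool (?A u w) \<le> real r * of_bool (twin u w) + of_bool (E u w \<and> \<not> twin u w)"
        using agr_le_1[of u w] agr_twin[of u w] u U by (cases "twin u w") auto
    qed
    also have "\<dots> = real r * real (card {w \<in> U. twin u w}) + real (card {v \<in> U. E u v \<and> \<not> twin u v})"
      by (simp only: sum.distrib sum_distrib_left[symmetric] card_Collect_real[OF finU])
    also have "\<dots> \<le> real r * real b + real (card {v \<in> U. E u v \<and> \<not> twin u v})"
    proof -
      have "u \<in> V" using u U by blast
      have "card {w \<in> U. twin u w} \<le> card {w \<in> V. twin u w}"
        using finite_V U by (intro card_mono) auto
      then have "card {w \<in> U. twin u w} \<le> b"
        by (simp only: card_twin[OF \<open>u \<in> V\<close>])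
      then show ?thesis by (simp add: mult_left_mono)
    qed
    finally show "(\<Sum>w\<in>U. agr u w * of_bool (?A u w))
        \<le> real r * real b + real (card {v \<in> U. E u v \<and> \<not> twin u v})" .
  qed
  also have "\<dots> = real r * real b * real (card U) + (\<Sum>u\<in>U. real (card {v \<in> U. E u v \<and> \<not> twin u v}))"
    by (simp add: sum.distrib)
  finally have "real r * real (card U) ^ 2 \<le> real q * (real s * (real r * real b * real (card U)
        + (\<Sum>u\<in>U. real (card {v \<in> U. E u v \<and> \<not> twin u v}))))"
    by (simp add: mult_left_mono mult.assoc)
  then show ?thesis using levels by (simp add: field_simps)
qed

end

section \<open>The graph of collinear points and its Ramsey property\<close>

context orthogonal_array
begin

definition adj :: "'a \<Rightarrow> 'a \<Rightarrow> bool" where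
  "adj u v \<longleftrightarrow> u \<noteq> v \<and> (\<exists>m<r. L m u = L m v)"

definition line_graph :: "'a graph" where
  "line_graph = (V, {{u, v} | u v. u \<in> V \<and> v \<in> V \<and> adj u v})"

definition nbs :: "('a set \<Rightarrow> bool) \<Rightarrow> bool \<Rightarrow> 'a \<Rightarrow> 'a set" where
  "nbs \<chi> \<beta> v = {w \<in> V. adj v w \<and> \<chi> {v, w} = \<beta>}"

lemma adj_sym: "adj u v \<Longrightarrow> adj v u"
  by (auto simp: adj_def eq_commute)

lemma verts_line_graph [simp]: "verts line_graph = V"
  by (simp add: line_graph_def)

lemma edges_line_graph: "u \<in> V \<Longrightarrow> v \<in> V \<Longrightarrow> adj u v \<Longrightarrow> {u, v} \<in> edges line_graph"
  by (auto simp: line_graph_def)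

lemma simple_graph_line_graph: "simple_graph line_graph"
  using finite_V by (auto simp: simple_graph_def line_graph_def nsets_def adj_def)

lemma nbs_subset: "nbs \<chi> \<beta> v \<subseteq> V"
  by (auto simp: nbs_def)

lemma finite_nbs: "finite (nbs \<chi> \<beta> v)"
  using nbs_subset finite_V by (rule finite_subset)

lemma agr_ge_1:
  assumes "adj u v"
  shows "1 \<le> agr u v"
proof -
  from assms obtain m where m: "m < r" "L m u = L m v" by (auto simp: adj_def)
  then have "of_bool (L m u = L m v) \<le> agr u v"
    unfolding agr_def by (intro member_le_sum) auto
  then show ?thesis using m by simp
qed

lemma card_adj_le:
  assumes "u \<in> V"
  shows "card {v \<in> V. adj u v} \<le> r * q * b"
proof -
  have "real (card {v \<in> V. adj u v}) = (\<Sum>v\<in>V. of_bool (adj u v))"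
    by (rule card_Collect_real[OF finite_V])
  also have "\<dots> \<le> (\<Sum>v\<in>V. agr v u)"
    by (rule sum_mono) (use agr_ge_1[OF adj_sym] agr_nonneg in \<open>auto simp: of_bool_def\<close>)
  also have "\<dots> = real (r * q * b)" by (rule sum_agr[OF assms])
  finally show ?thesis by linarith
qed

text \<open>Agreements overcount neighbours only at the \<open>b\<close> twins of \<open>u\<close>,
  which include \<open>u\<close> itself; this loses at most \<open>r * b\<close>.\<close>

lemma card_adj_ge:
  assumes "u \<in> V"
  shows "r * q * b \<le> card {v \<in> V. adj u v} + r * b"
proof -
  have "real (r * q * b) = (\<Sum>v\<in>V. agr u v)" by (simp only: sum_agr[OF assms, symmetric] agr_commute)
  also have "\<dots> \<le> (\<Sum>v\<in>V. of_bool (adj u v) + real r * of_bool (twin u v))"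
  proof (rule sum_mono)
    fix v assume v: "v \<in> V"
    show "agr u v \<le> of_bool (adj u v) + real r * of_bool (twin u v)"
    proof (cases "twin u v")
      case False
      then have "u \<noteq> v" using twin_refl by auto
      have "agr u v = 0" if "\<not> adj u v"
        using that \<open>u \<noteq> v\<close> by (auto simp: agr_def adj_def)
      then show ?thesis using agr_le_1[OF assms v False] False by (cases "adj u v") auto
    qed (simp add: agr_twin)
  qed
  also have "\<dots> = real (card {v \<in> V. adj u v}) + real r * real (card {v \<in> V. twin u v})"
    by (simp only: sum.distrib sum_distrib_left[symmetric] card_Collect_real[OF finite_V])
  finally have "real (r * q * b) \<le> real (card {v \<in> V. adj u v} + r * b)"
    by (simp add: card_twin[OF assms])
  then show ?thesis by linarith
qed

text \<open>Ordered adjacent pairs are counted, which gives away a factor of 2.\<close>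

lemma card_edges_line_graph: "card (edges line_graph) \<le> card V * (r * q * b)"
proof -
  let ?S = "SIGMA u:V. {v \<in> V. adj u v}"
  have fin: "finite ?S" using finite_V by auto
  have "edges line_graph = (\<lambda>(u, v). {u, v}) ` ?S"
    by (auto simp: line_graph_def)
  then have "card (edges line_graph) \<le> card ?S"
    using card_image_le[OF fin] by simp
  also have "\<dots> = (\<Sum>u\<in>V. card {v \<in> V. adj u v})"
    using finite_V by (intro card_SigmaI) auto
  also have "\<dots> \<le> (\<Sum>u\<in>V. r * q * b)"
    by (intro sum_mono card_adj_le)
  finally show ?thesis by simp
qed

lemma card_nbs:
  assumes "v \<in> V"
  shows "r * q * b \<le> card (nbs \<chi> True v) + card (nbs \<chi> False v) + r * b"
proof -
  have "{w \<in> V. adj v w} = nbs \<chi> True v \<union> nbs \<chi> False v"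
    by (auto simp: nbs_def)
  then have "card {w \<in> V. adj v w} \<le> card (nbs \<chi> True v) + card (nbs \<chi> False v)"
    by (simp only: card_Un_le)
  then show ?thesis using card_adj_ge[OF assms] by linarith
qed

text \<open>Lightness bounds the overlap of two coloured neighbourhoods, and
  \<open>4 * k * r \<le> q\<close> makes all overlaps at \<open>v\<close> together at most half of
  its neighbourhood. Of the other half, at least \<open>n + k\<close> vertices, at most
  \<open>k\<close> lie in \<open>K\<close>, so \<open>n\<close> private leaves remain.\<close>

lemma starburst_in_clique:
  fixes \<chi> :: "'a set \<Rightarrow> bool"
  assumes K: "K \<subseteq> V" "card K = k" and kr: "4 * k * r \<le> q"
    and core: "\<And>u v. u \<in> K \<Longrightarrow> v \<in> K \<Longrightarrow> u \<noteq> v \<Longrightarrow> adj u v \<and> \<chi> {u, v} = \<beta>"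
    and rich: "\<And>v. v \<in> K \<Longrightarrow> 2 * (n + k) \<le> card (nbs \<chi> \<beta> v)"
    and light: "\<And>u v. u \<in> K \<Longrightarrow> v \<in> K \<Longrightarrow> u \<noteq> v \<Longrightarrow>
      weight u (nbs \<chi> \<beta> v) \<le> 2 * (real r / real q) * real (card (nbs \<chi> \<beta> v))"
  shows "\<exists>F. is_copy F (starburst k n) line_graph \<and> (\<exists>b. \<forall>e\<in>edges F. \<chi> e = b)"
proof -
  let ?N = "nbs \<chi> \<beta>"
  have finK: "finite K" using K finite_V finite_subset by blast
  have overlap: "real (card (?N u \<inter> ?N v)) \<le> weight u (?N v)" for u v
  proof -
    have "real (card (?N u \<inter> ?N v)) = (\<Sum>w\<in>?N u \<inter> ?N v. 1)" by simp
    also have "\<dots> \<le> (\<Sum>w\<in>?N u \<inter> ?N v. agr u w)"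
      by (rule sum_mono) (auto simp: nbs_def agr_ge_1)
    also have "\<dots> \<le> weight u (?N v)"
      unfolding weight_def by (rule sum_mono2) (auto simp: finite_nbs agr_nonneg)
    finally show ?thesis .
  qed
  define A where "A v = ?N v - (K \<union> (\<Union>u\<in>K - {v}. ?N u))" for v
  have "n \<le> card (A v)" if v: "v \<in> K" for v
  proof -
    let ?x = "real (card (?N v))"
    have "?N v \<subseteq> A v \<union> (K \<union> (\<Union>u\<in>K - {v}. ?N u \<inter> ?N v))" by (auto simp: A_def)
    then have "card (?N v) \<le> card (A v \<union> (K \<union> (\<Union>u\<in>K - {v}. ?N u \<inter> ?N v)))"
      by (intro card_mono) (auto simp: A_def finK finite_nbs)
    also have "\<dots> \<le> card (A v) + (card K + (\<Sum>u\<in>K - {v}. card (?N u \<inter> ?N v)))"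
      by (intro order_trans[OF card_Un_le] add_left_mono card_UN_le) (use finK in auto)
    finally have "?x \<le> real (card (A v) + (k + (\<Sum>u\<in>K - {v}. card (?N u \<inter> ?N v))))"
      unfolding K(2) by (rule of_nat_mono)
    also have "\<dots> = real (card (A v)) + real k + (\<Sum>u\<in>K - {v}. real (card (?N u \<inter> ?N v)))"
      by simp
    also have "(\<Sum>u\<in>K - {v}. real (card (?N u \<inter> ?N v))) \<le> (\<Sum>u\<in>K - {v}. 2 * (real r / real q) * ?x)"
      by (intro sum_mono order_trans[OF overlap light]) (use v in auto)
    also have "\<dots> \<le> real k * (2 * (real r / real q) * ?x)"
      unfolding sum_constant using K(2) finK card_mono[of K "K - {v}"]
      by (intro mult_right_mono of_nat_mono) auto
    also have "\<dots> \<le> ?x / 2"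
    proof -
      have "real (4 * k * r) \<le> real q" using kr by (rule of_nat_mono)
      then have "real k * (2 * (real r / real q)) \<le> 1 / 2" using levels by (simp add: field_simps)
      then have "real k * (2 * (real r / real q)) * ?x \<le> 1 / 2 * ?x" by (rule mult_right_mono) simp
      then show ?thesis by (simp add: mult.assoc)
    qed
    finally have "real (card (?N v)) \<le> real (2 * (card (A v) + k))" by simp
    then have "card (?N v) \<le> 2 * (card (A v) + k)" by (simp only: of_nat_le_iff)
    with rich[OF v] have "2 * (n + k) \<le> 2 * (card (A v) + k)" by (rule order_trans)
    then show ?thesis by simp
  qed
  then have "\<forall>v\<in>K. \<exists>T\<subseteq>A v. card T = n"
    by (metis obtain_subset_with_card_n)
  from bchoice[OF this] obtain T where T: "\<And>v. v \<in> K \<Longrightarrow> T v \<subseteq> A v \<and> card (T v) = n" by blast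
  show ?thesis
  proof (rule starburst_copyI[OF simple_graph_line_graph _ finK K(2), where A = T and \<chi> = \<chi> and \<beta> = \<beta>])
    show "K \<subseteq> verts line_graph" using K by simp
    show "T v \<subseteq> verts line_graph" if "v \<in> K" for v
      using T[OF that] by (auto simp: A_def nbs_def)
    show "card (T v) = n" if "v \<in> K" for v using T[OF that] by simp
    show "T v \<inter> K = {}" if "v \<in> K" for v using T[OF that] by (auto simp: A_def)
    show "T u \<inter> T v = {}" if "u \<in> K" "v \<in> K" "u \<noteq> v" for u v
      using T[OF that(1)] T[OF that(2)] that by (auto simp: A_def)
    show "{u, v} \<in> edges line_graph \<and> \<chi> {u, v} = \<beta>" if "u \<in> K" "v \<in> K" "u \<noteq> v" for u v
      using core[OF that] that K(1) by (auto intro: edges_line_graph)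
    show "{v, w} \<in> edges line_graph \<and> \<chi> {v, w} = \<beta>" if "v \<in> K" "w \<in> T v" for v w
      using T[OF that(1)] that K(1) by (auto simp: A_def nbs_def intro: edges_line_graph)
  qed
qed

text \<open>If there were no copy, \<open>V\<close> would be covered by the vertices rich in only
  one colour and those rich in both, where rich means colour degree at least \<open>D\<close>. The
  assumption \<open>poor\<close> makes each of the first two sets smaller than a third of
  \<open>V\<close>, and \<open>both\<close> does so for the last; the 9 is the square of 3.
  \<open>R\<close> is a Ramsey number for cliques of size \<open>k\<close>.\<close>

lemma is_ramsey_for_line_graph:
  fixes k n R :: nat
  defines "D \<equiv> 2 * (n + k)"
  assumes k: "0 < k" and b: "0 < b" and kr: "4 * k * r \<le> q" and rb: "r * b \<le> D"
    and deg: "2 * D + r * b \<le> r * q * b"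
    and R: "\<And>(W :: 'a set) E. finite W \<Longrightarrow> R \<le> card W \<Longrightarrow>
      \<exists>K\<subseteq>W. card K = k \<and> clique K E \<or> card K = k \<and> indep K E"
    and poor: "real k * (real r * real b + real D + 8 * real q ^ 3 * real b / real r ^ 2)
      < real r * real q * real b / 9"
    and both: "real R * (real r * real b + 8 * real q ^ 3 * real b / real r ^ 2)
      < real r * real q * real b / 9"
  shows "is_ramsey_for line_graph (starburst k n)"
  unfolding is_ramsey_for_def
proof (rule allI, rule ccontr)
  fix \<chi> :: "'a set \<Rightarrow> bool"
  assume no_copy: "\<not> (\<exists>F. is_copy F (starburst k n) line_graph \<and> (\<exists>b. \<forall>e\<in>edges F. \<chi> e = b))"
  let ?N = "nbs \<chi>"
  \<comment> \<open>Bad pairs are ordered: \<open>u\<close> is heavy for the neighbourhood of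
    \<open>v\<close>. Only neighbourhoods of size at least \<open>D\<close> are tested, and by
    \<open>r * b \<le> D\<close> they are large enough for \<open>card_heavy\<close>.\<close>
  define bad where "bad u v \<longleftrightarrow> (\<exists>\<beta>. D \<le> card (?N \<beta> v) \<and>
    2 * (real r / real q) * real (card (?N \<beta> v)) < weight u (?N \<beta> v))" for u v
  define X where "X \<beta> = {v \<in> V. D \<le> card (?N \<beta> v) \<and> card (?N (\<not> \<beta>) v) < D}" for \<beta>
  define Z where "Z = {v \<in> V. D \<le> card (?N True v) \<and> D \<le> card (?N False v)}"
  define B where "B = (\<Sum>v\<in>V. real (card {u \<in> V. bad u v}))"
  have r0: "0 < r" using columns by simp
  have D0: "0 < D" using k by (simp add: D_def)
  have B': "B = (\<Sum>u\<in>V. real (card {v \<in> V. bad u v}))"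
    unfolding B_def card_Collect_real[OF finite_V] by (rule sum.swap)
  \<comment> \<open>Both orientations of a bad pair count, hence \<open>2 * B\<close>.\<close>
  have Bsub: "(\<Sum>u\<in>U. real (card {v \<in> U. bad u v}) + real (card {v \<in> U. bad v u})) \<le> 2 * B"
    if "U \<subseteq> V" for U
  proof -
    have "(\<Sum>u\<in>U. real (card {v \<in> U. bad u v}) + real (card {v \<in> U. bad v u}))
        \<le> (\<Sum>u\<in>U. real (card {v \<in> V. bad u v}) + real (card {v \<in> V. bad v u}))"
      using that finite_V by (intro sum_mono add_mono of_nat_mono card_mono) auto
    also have "\<dots> \<le> (\<Sum>u\<in>V. real (card {v \<in> V. bad u v}) + real (card {v \<in> V. bad v u}))"
      using that finite_V by (intro sum_mono2) auto
    also have "\<dots> = 2 * B" by (simp only: sum.distrib B_def[symmetric] B'[symmetric])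
    finally show ?thesis .
  qed
  have B_le: "B * real r ^ 2 \<le> real (card V) * (4 * real q ^ 3 * real b)"
  proof -
    let ?H = "\<lambda>\<beta> v. {u \<in> V. D \<le> card (?N \<beta> v) \<and>
      2 * (real r / real q) * real (card (?N \<beta> v)) < weight u (?N \<beta> v)}"
    have H: "real (card (?H \<beta> v)) * real r ^ 2 \<le> 2 * real q ^ 3 * real b" for \<beta> v
    proof (cases "D \<le> card (?N \<beta> v)")
      case True
      then have "?N \<beta> v \<noteq> {}" using D0 by auto
      with True show ?thesis using card_heavy[OF nbs_subset, of \<chi> \<beta> v] rb by simp
    qed simp
    have "real (card {u \<in> V. bad u v}) * real r ^ 2 \<le> 4 * real q ^ 3 * real b" for v
    proof -
      have "{u \<in> V. bad u v} = ?H True v \<union> ?H False v"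
        unfolding bad_def by (auto simp: ex_bool_eq)
      then have "real (card {u \<in> V. bad u v}) \<le> real (card (?H True v) + card (?H False v))"
        by (intro of_nat_mono) (simp only: card_Un_le)
      then have "real (card {u \<in> V. bad u v}) * real r ^ 2
          \<le> (real (card (?H True v)) + real (card (?H False v))) * real r ^ 2"
        by (intro mult_right_mono) simp_all
      also have "\<dots> \<le> 4 * real q ^ 3 * real b"
        using H[of True v] H[of False v] by (simp add: distrib_right)
      finally show ?thesis .
    qed
    then have "(\<Sum>v\<in>V. real (card {u \<in> V. bad u v}) * real r ^ 2)
        \<le> (\<Sum>v\<in>V. 4 * real q ^ 3 * real b)" by (intro sum_mono)
    then show ?thesis by (simp add: B_def sum_distrib_right)
  qed
  \<comment> \<open>Vertices on a common line are pairwise adjacent, so such a set \<open>K\<close>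
    would be the core of a monochromatic starburst.\<close>
  have no_clique: False
    if K: "K \<subseteq> {u \<in> V. L m u = c}" "m < r" "card K = k"
      and mono: "\<And>u v. u \<in> K \<Longrightarrow> v \<in> K \<Longrightarrow> u \<noteq> v \<Longrightarrow> \<chi> {u, v} = \<beta> \<and> \<not> bad u v"
      and rich: "\<And>v. v \<in> K \<Longrightarrow> D \<le> card (?N \<beta> v)" for K m c \<beta>
  proof -
    have "\<exists>F. is_copy F (starburst k n) line_graph \<and> (\<exists>b. \<forall>e\<in>edges F. \<chi> e = b)"
    proof (rule starburst_in_clique[of K k \<chi> \<beta> n])
      fix u v assume uv: "u \<in> K" "v \<in> K" "u \<noteq> v"
      then show "adj u v \<and> \<chi> {u, v} = \<beta>" using K mono[OF uv] by (auto simp: adj_def)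
      show "weight u (?N \<beta> v) \<le> 2 * (real r / real q) * real (card (?N \<beta> v))"
        using mono[OF uv] rich[OF uv(2)] unfolding bad_def by (meson not_le)
    qed (use K kr rich in \<open>auto simp: D_def\<close>)
    with no_copy show False ..
  qed
  let ?p = "real r / real q"
  have X: "?p * real (card (X \<beta>)) ^ 2
    \<le> real k * (real r * real b * real (card (X \<beta>)) + (real (card (X \<beta>)) * real D + 2 * B))" for \<beta>
  proof -
    \<comment> \<open>On a line, an independent set for this relation is a clique in colour
      \<open>\<beta>\<close> with good pairs, so it has fewer than \<open>k\<close>
      vertices.\<close>
    let ?E = "\<lambda>u v. adj u v \<and> \<chi> {u, v} = (\<not> \<beta>) \<or> bad u v \<or> bad v u"
    have sub: "X \<beta> \<subseteq> V" by (auto simp: X_def)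
    have "?p * real (card (X \<beta>)) ^ 2 \<le> real (k - 1) * (real r * real b * real (card (X \<beta>))
        + (\<Sum>u\<in>X \<beta>. real (card {v \<in> X \<beta>. ?E u v \<and> \<not> twin u v})))"
    proof (rule turan_lines[OF sub])
      show "?E v u" if "?E u v" for u v
        using that adj_sym by (auto simp: insert_commute)
      fix m c I assume I: "m < r" "I \<subseteq> {u \<in> X \<beta>. L m u = c}" "card I = Suc (k - 1)"
      show "\<exists>u\<in>I. \<exists>v\<in>I. u \<noteq> v \<and> (?E u v \<or> twin u v)"
      proof (rule ccontr)
        assume "\<not> ?thesis"
        then have nE: "\<not> ?E u v" if "u \<in> I" "v \<in> I" "u \<noteq> v" for u v using that by blast
        show False
        proof (rule no_clique[of I m c \<beta>])
          fix u v assume uv: "u \<in> I" "v \<in> I" "u \<noteq> v"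
          then have "adj u v" using I by (auto simp: adj_def)
          then show "\<chi> {u, v} = \<beta> \<and> \<not> bad u v" using nE[OF uv] by auto
        qed (use I k sub in \<open>auto simp: X_def\<close>)
      qed
    qed
    also have "\<dots> \<le> real k * (real r * real b * real (card (X \<beta>))
        + (real (card (X \<beta>)) * real D + 2 * B))"
    proof (intro mult_mono add_left_mono)
      \<comment> \<open>A vertex of \<open>X \<beta>\<close> has fewer than \<open>D\<close>
        neighbours in the other colour; all remaining related pairs are bad.\<close>
      have "real (card {v \<in> X \<beta>. ?E u v \<and> \<not> twin u v})
          \<le> real D + (real (card {v \<in> X \<beta>. bad u v}) + real (card {v \<in> X \<beta>. bad v u}))"
        if u: "u \<in> X \<beta>" for u
      proof -
        have "finite (X \<beta>)" using sub finite_V finite_subset by blast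
        have "{v \<in> X \<beta>. ?E u v \<and> \<not> twin u v}
            \<subseteq> ?N (\<not> \<beta>) u \<union> ({v \<in> X \<beta>. bad u v} \<union> {v \<in> X \<beta>. bad v u})"
          using sub by (auto simp: nbs_def)
        then have "card {v \<in> X \<beta>. ?E u v \<and> \<not> twin u v}
            \<le> card (?N (\<not> \<beta>) u \<union> ({v \<in> X \<beta>. bad u v} \<union> {v \<in> X \<beta>. bad v u}))"
          using \<open>finite (X \<beta>)\<close> by (intro card_mono) (auto simp: finite_nbs)
        also have "\<dots> \<le> card (?N (\<not> \<beta>) u) + (card {v \<in> X \<beta>. bad u v} + card {v \<in> X \<beta>. bad v u})"
          by (intro order_trans[OF card_Un_le] add_left_mono card_Un_le)
        also have "card (?N (\<not> \<beta>) u) \<le> D" using u by (simp add: X_def)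
        finally show ?thesis by linarith
      qed
      then have "(\<Sum>u\<in>X \<beta>. real (card {v \<in> X \<beta>. ?E u v \<and> \<not> twin u v}))
          \<le> (\<Sum>u\<in>X \<beta>. real D + (real (card {v \<in> X \<beta>. bad u v}) + real (card {v \<in> X \<beta>. bad v u})))"
        by (rule sum_mono)
      also have "\<dots> \<le> real (card (X \<beta>)) * real D + 2 * B"
        using Bsub[OF sub] by (simp add: sum.distrib)
      finally show "(\<Sum>u\<in>X \<beta>. real (card {v \<in> X \<beta>. ?E u v \<and> \<not> twin u v}))
          \<le> real (card (X \<beta>)) * real D + 2 * B" .
    qed (auto simp: sum_nonneg)
    finally show ?thesis .
  qed
  have Z: "?p * real (card Z) ^ 2 \<le> real R * (real r * real b * real (card Z) + 2 * B)"
  proof -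
    \<comment> \<open>Colours are left out of this relation: an independent set of size
      \<open>R\<close> on a line contains a monochromatic \<open>k\<close>-set by Ramsey's theorem,
      and vertices of \<open>Z\<close> are rich in whichever colour occurs.\<close>
    let ?E = "\<lambda>u v. bad u v \<or> bad v u"
    have sub: "Z \<subseteq> V" by (auto simp: Z_def)
    have "?p * real (card Z) ^ 2 \<le> real R * (real r * real b * real (card Z)
        + (\<Sum>u\<in>Z. real (card {v \<in> Z. ?E u v \<and> \<not> twin u v})))"
    proof (rule turan_lines[OF sub])
      fix m c I assume I: "m < r" "I \<subseteq> {u \<in> Z. L m u = c}" "card I = Suc R"
      show "\<exists>u\<in>I. \<exists>v\<in>I. u \<noteq> v \<and> (?E u v \<or> twin u v)"
      proof (rule ccontr)
        assume "\<not> ?thesis"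
        then have nE: "\<not> bad u v" if "u \<in> I" "v \<in> I" "u \<noteq> v" for u v using that by blast
        have "finite I" using I(3) by (intro card_ge_0_finite) simp
        then obtain K where "K \<subseteq> I" "card K = k \<and> clique K {e. \<chi> e} \<or> card K = k \<and> indep K {e. \<chi> e}"
          using R[of I "{e. \<chi> e}"] I(3) by auto
        then obtain \<beta> where K: "K \<subseteq> I" "card K = k"
          "\<And>u v. u \<in> K \<Longrightarrow> v \<in> K \<Longrightarrow> u \<noteq> v \<Longrightarrow> \<chi> {u, v} = \<beta>"
          unfolding clique_def indep_def by blast
        show False
        proof (rule no_clique[of K m c \<beta>])
          fix u v assume uv: "u \<in> K" "v \<in> K" "u \<noteq> v"
          then show "\<chi> {u, v} = \<beta> \<and> \<not> bad u v" using nE K by blast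
        next
          fix v assume "v \<in> K"
          then show "D \<le> card (?N \<beta> v)" using I K by (cases \<beta>) (auto simp: Z_def)
        qed (use I K sub in auto)
      qed
    qed auto
    also have "\<dots> \<le> real R * (real r * real b * real (card Z) + 2 * B)"
    proof (intro mult_left_mono add_left_mono)
      have "finite Z" using sub finite_V finite_subset by blast
      have "real (card {v \<in> Z. ?E u v \<and> \<not> twin u v})
          \<le> real (card {v \<in> Z. bad u v}) + real (card {v \<in> Z. bad v u})" for u
      proof -
        have "card {v \<in> Z. ?E u v \<and> \<not> twin u v} \<le> card ({v \<in> Z. bad u v} \<union> {v \<in> Z. bad v u})"
          using \<open>finite Z\<close> by (intro card_mono) auto
        also have "\<dots> \<le> card {v \<in> Z. bad u v} + card {v \<in> Z. bad v u}" by (rule card_Un_le)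
        finally show ?thesis by linarith
      qed
      then have "(\<Sum>u\<in>Z. real (card {v \<in> Z. ?E u v \<and> \<not> twin u v}))
          \<le> (\<Sum>u\<in>Z. real (card {v \<in> Z. bad u v}) + real (card {v \<in> Z. bad v u}))"
        by (rule sum_mono)
      also have "\<dots> \<le> 2 * B" by (rule Bsub[OF sub])
      finally show "(\<Sum>u\<in>Z. real (card {v \<in> Z. ?E u v \<and> \<not> twin u v})) \<le> 2 * B" .
    qed simp
    finally show ?thesis .
  qed
  let ?n = "real (card V)"
  have n0: "0 < ?n" using levels b by (simp add: card_V)
  have pn: "?p * ?n = real r * real q * real b" using levels by (simp add: card_V)
  have B_div: "2 * B \<le> ?n * (8 * real q ^ 3 * real b / real r ^ 2)"
    using B_le r0 by (simp add: field_simps)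
  \<comment> \<open>If \<open>U\<close> had a third of all vertices, the left side of
    \<open>le\<close> would be at least \<open>?n * (r * q * b / 9)\<close>, while replacing
    \<open>card U\<close> by \<open>?n\<close> on the right keeps it strictly below this.\<close>
  have small: "3 * real (card U) < ?n"
    if U: "U \<subseteq> V" and le: "?p * real (card U) ^ 2 \<le> s * (real (card U) * y + 2 * B)"
      and lt: "s * (y + 8 * real q ^ 3 * real b / real r ^ 2) < real r * real q * real b / 9"
      and nonneg: "0 \<le> s" "0 \<le> y" for U s y
  proof (rule ccontr)
    assume "\<not> ?thesis"
    then have "?n / 3 \<le> real (card U)" by simp
    then have "?p * (?n / 3) ^ 2 \<le> ?p * real (card U) ^ 2"
      using n0 by (intro mult_left_mono power_mono) auto
    also have "\<dots> \<le> s * (real (card U) * y + 2 * B)" by (rule le)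
    also have "\<dots> \<le> s * (?n * y + ?n * (8 * real q ^ 3 * real b / real r ^ 2))"
      using B_div card_mono[OF finite_V U] nonneg
      by (intro mult_left_mono add_mono mult_right_mono) auto
    also have "\<dots> = ?n * (s * (y + 8 * real q ^ 3 * real b / real r ^ 2))"
      by (simp add: algebra_simps)
    also have "\<dots> < ?n * (real r * real q * real b / 9)"
      using lt n0 by (rule mult_strict_left_mono)
    also have "\<dots> = ?p * (?n / 3) ^ 2"
      unfolding pn[symmetric] by (simp add: power2_eq_square)
    finally show False by simp
  qed
  have "3 * real (card (X \<beta>)) < ?n" for \<beta>
    by (rule small[of _ "real k" "real r * real b + real D"])
      (use X[of \<beta>] poor in \<open>auto simp: X_def algebra_simps\<close>)
  moreover have "3 * real (card Z) < ?n"
    by (rule small[of _ "real R" "real r * real b"])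
      (use Z both in \<open>auto simp: Z_def algebra_simps\<close>)
  moreover have "?n \<le> real (card (X True)) + real (card (X False)) + real (card Z)"
  proof -
    \<comment> \<open>By \<open>deg\<close> the two colour degrees add up to at least
      \<open>2 * D\<close>, so every vertex is rich in some colour.\<close>
    have "v \<in> X True \<union> X False \<union> Z" if "v \<in> V" for v
      using card_nbs[OF that, of \<chi>] deg that unfolding X_def Z_def by auto
    then have "V \<subseteq> X True \<union> X False \<union> Z" by blast
    then have "card V \<le> card (X True \<union> X False \<union> Z)"
      by (rule card_mono[rotated]) (auto simp: X_def Z_def finite_V)
    also have "\<dots> \<le> card (X True) + card (X False) + card Z"
      by (intro order_trans[OF card_Un_le] add_right_mono card_Un_le)
    finally show ?thesis by linarith
  qed
  ultimately show False
    using \<open>\<And>\<beta>. 3 * real (card (X \<beta>)) < ?n\<close>[of True]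
      \<open>\<And>\<beta>. 3 * real (card (X \<beta>)) < ?n\<close>[of False] by linarith
qed

end

section \<open>The upper bound\<close>

text \<open>The number \<open>v\<close> encodes the point with coordinates
  \<open>x = v mod q\<close> and \<open>y = v div q mod q\<close>, and \<open>v div (q * q)\<close>
  tells its copies apart. The value is the constant \<open>c\<close> in the line equation
  \<open>y + m * x = c\<close> modulo \<open>q\<close>.\<close>

definition plane_line :: "nat \<Rightarrow> nat \<Rightarrow> nat \<Rightarrow> nat" where
  "plane_line q m v = (v div q mod q + m * (v mod q)) mod q"

text \<open>Subtracting the two congruences shows that the prime \<open>q\<close> divides
  \<open>(m - m') * (x - x')\<close>. The argument runs over the integers because subtraction of
  naturals truncates.\<close>

lemma two_lines_inj:
  fixes q m m' x y x' y' :: nat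
  assumes q: "prime q" and m: "m < q" "m' < q" "m \<noteq> m'"
    and xy: "x < q" "y < q" "x' < q" "y' < q"
    and eq: "(y + m * x) mod q = (y' + m * x') mod q"
      "(y + m' * x) mod q = (y' + m' * x') mod q"
  shows "x = x' \<and> y = y'"
proof -
  have dvd_small: "s = t" if "int q dvd int s - int t" "s < q" "t < q" for s t
    using that by (metis mod_eq_dvd_iff mod_less of_nat_eq_iff of_nat_mod)
  have 1: "int q dvd (int y + int m * int x) - (int y' + int m * int x')"
    using eq(1) by (metis mod_eq_dvd_iff of_nat_add of_nat_mod of_nat_mult)
  have 2: "int q dvd (int y + int m' * int x) - (int y' + int m' * int x')"
    using eq(2) by (metis mod_eq_dvd_iff of_nat_add of_nat_mod of_nat_mult)
  have "int q dvd (int m - int m') * (int x - int x')"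
    using dvd_diff[OF 1 2] by (simp add: algebra_simps)
  moreover have "prime (int q)" using q by simp
  ultimately have "int q dvd int m - int m' \<or> int q dvd int x - int x'"
    by (simp add: prime_dvd_mult_iff)
  then have x: "x = x'" using dvd_small[of m m'] dvd_small[of x x'] m xy by blast
  then have "int q dvd int y - int y'" using 1 by simp
  with x show ?thesis using dvd_small xy by blast
qed

lemma plane_orthogonal_array:
  assumes q: "prime q" and r: "2 \<le> r" "r \<le> q"
  shows "orthogonal_array {..<q * q * b} (plane_line q) r q b"
proof
  have q0: "0 < q" using q prime_gt_0_nat by blast
  show "finite {..<q * q * b}" "2 \<le> r" "0 < q" using r q0 by auto
  show "plane_line q m v < q" for m v using q0 by (simp add: plane_line_def)
next
  fix m m' c c' assume m: "m < r" "m' < r" "m \<noteq> m'" and c: "c < q" "c' < q"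
  have q0: "0 < q" using q prime_gt_0_nat by blast
  let ?S = "{..<q} \<times> {..<q}"
  \<comment> \<open>An injective map of the finite square into itself is onto, so lines of two
    different classes meet in a point.\<close>
  let ?f = "\<lambda>(x, y). ((y + m * x) mod q, (y + m' * x) mod q)"
  have "inj_on ?f ?S"
  proof (rule inj_onI)
    fix s t assume "s \<in> ?S" "t \<in> ?S" "?f s = ?f t"
    then show "s = t"
      using two_lines_inj[OF q, of m m' "fst s" "snd s" "fst t" "snd t"] m r
      by (auto simp: case_prod_beta)
  qed
  moreover have "?f ` ?S \<subseteq> ?S" using q0 by auto
  ultimately have "?f ` ?S = ?S" by (intro endo_inj_surj) auto
  then have "(c, c') \<in> ?f ` ?S" using c by simp
  then obtain x y where xy: "x < q" "y < q" "(y + m * x) mod q = c" "(y + m' * x) mod q = c'"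
    by auto
  \<comment> \<open>Enumerates the \<open>b\<close> copies of the intersection point.\<close>
  let ?g = "\<lambda>i. i * (q * q) + (y * q + x)"
  have lt: "y * q + x < q * q"
  proof -
    have "y * q + x < Suc y * q" using xy by simp
    also have "\<dots> \<le> q * q" using xy by (intro mult_le_mono1) simp
    finally show ?thesis .
  qed
  have g: "?g i mod q = x" "?g i div q mod q = y" for i
  proof -
    have eq: "?g i = x + q * (y + q * i)" by (simp add: algebra_simps)
    show "?g i mod q = x" "?g i div q mod q = y" unfolding eq using xy by simp_all
  qed
  have "{v \<in> {..<q * q * b}. plane_line q m v = c \<and> plane_line q m' v = c'} = ?g ` {..<b}"
  proof (intro set_eqI iffI)
    fix v assume v: "v \<in> {v \<in> {..<q * q * b}. plane_line q m v = c \<and> plane_line q m' v = c'}"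
    have "v mod q = x \<and> v div q mod q = y"
      using v xy q0 m r by (intro two_lines_inj[OF q, of m m']) (auto simp: plane_line_def)
    then have "v mod (q * q) = y * q + x"
      by (simp add: mod_mult2_eq)
    then have "v = ?g (v div (q * q))"
      by (metis div_mult_mod_eq)
    moreover have "v div (q * q) < b"
      using v by (simp add: less_mult_imp_div_less mult.commute)
    ultimately show "v \<in> ?g ` {..<b}" by blast
  next
    fix v assume "v \<in> ?g ` {..<b}"
    then obtain i where i: "i < b" "v = ?g i" by blast
    have "v < Suc i * (q * q)" using lt i by simp
    also have "\<dots> \<le> b * (q * q)" using i by (intro mult_le_mono1) simp
    finally have "v < q * q * b" by (simp add: mult.commute)
    then show "v \<in> {v \<in> {..<q * q * b}. plane_line q m v = c \<and> plane_line q m' v = c'}"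
      using g[of i] xy i(2) by (simp add: plane_line_def)
  qed
  moreover have "inj_on ?g {..<b}" using q0 by (auto simp: inj_on_def)
  ultimately show "card {v \<in> {..<q * q * b}. plane_line q m v = c \<and> plane_line q m' v = c'} = b"
    by (simp add: card_image)
next
  fix u v m m' i
  assume "m < r" "m' < r" "m \<noteq> m'" "plane_line q m u = plane_line q m v"
    "plane_line q m' u = plane_line q m' v"
  moreover have "0 < q" using q prime_gt_0_nat by blast
  ultimately have "u mod q = v mod q \<and> u div q mod q = v div q mod q"
    using r by (intro two_lines_inj[OF q, of m m']) (auto simp: plane_line_def)
  then show "plane_line q i u = plane_line q i v" by (simp add: plane_line_def)
qed

text \<open>Everything is compared with \<open>y = N / k\<close>, which the degree
  \<open>r * q * b\<close> matches up to constants and which is about \<open>1200 * k * n\<close>.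
  The line size \<open>x = N / q\<close> is negligible: since \<open>q\<close> is large, even
  \<open>R * k ^ 3 * x\<close> is a tiny fraction of \<open>y\<close>.\<close>

lemma ramsey_numerics:
  fixes k n R q r b N :: real
  assumes k: "2 \<le> k" "k \<le> n" and R: "1 \<le> R" and q: "200000 * R * k ^ 4 \<le> q"
    and r: "4 * k * r \<le> q" "q \<le> 8 * k * r" and b: "0 < b"
    and N: "N = q ^ 2 * b" "1200 * k ^ 2 * n \<le> N" "N \<le> 1201 * k ^ 2 * n"
  shows "r * b \<le> 2 * (n + k)"
    and "4 * (n + k) + r * b \<le> r * q * b"
    and "k * (r * b + 2 * (n + k) + 8 * q ^ 3 * b / r ^ 2) < r * q * b / 9"
    and "R * (r * b + 8 * q ^ 3 * b / r ^ 2) < r * q * b / 9"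
    and "N * (r * q * b) \<le> 400000 * k ^ 3 * n ^ 2"
proof -
  have k4: "k * 8 \<le> k ^ 4"
    using power_mono[of 2 k 3] k by (simp add: power_numeral_reduce mult_left_mono)
  have Rk: "k ^ 4 \<le> R * k ^ 4" using mult_right_mono[OF R, of "k ^ 4"] k by simp
  have q_k: "1000 * k \<le> q" using k4 Rk q k by linarith
  have pos: "0 < k" "0 < q" "0 < N" "0 < n" using k q_k b N(1) by auto
  have r0: "0 < r" using r(2) pos by (smt (verit) zero_less_mult_iff)
  define x where "x = N / q"
  define y where "y = N / k"
  have xy: "0 < x" "0 < y" "x * q = N" "y * k = N" using pos by (simp_all add: x_def y_def)
  have qb: "q * b = x" using pos by (simp add: x_def N(1) power2_eq_square)
  have qqb: "q * (q * b) = y * k" using xy N(1) by (simp add: power2_eq_square)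
  have rb: "4 * (k * (r * b)) \<le> x"
    unfolding qb[symmetric] using mult_right_mono[OF r(1), of b] b by (simp add: mult.assoc)
  have rqb_up: "4 * (r * q * b) \<le> y" and rqb_low: "y \<le> 8 * (r * q * b)"
  proof -
    have "4 * k * r * (q * b) \<le> q * (q * b)" using r(1) b pos by (intro mult_right_mono) auto
    moreover have "4 * k * r * (q * b) = 4 * (r * q * b) * k" by simp
    ultimately have "4 * (r * q * b) * k \<le> y * k" by (simp only: qqb)
    then show "4 * (r * q * b) \<le> y" using pos by simp
    have "q * (q * b) \<le> 8 * k * r * (q * b)" using r(2) b pos by (intro mult_right_mono) auto
    moreover have "8 * k * r * (q * b) = 8 * (r * q * b) * k" by simp
    ultimately have "y * k \<le> 8 * (r * q * b) * k" by (simp only: qqb)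
    then show "y \<le> 8 * (r * q * b)" using pos by simp
  qed
  \<comment> \<open>This is the contribution of bad pairs; the assumption
    \<open>q \<le> 8 * k * r\<close> turns \<open>q ^ 2 / r ^ 2\<close> into at most
    \<open>64 * k ^ 2\<close>.\<close>
  have bad: "8 * q ^ 3 * b / r ^ 2 \<le> 512 * (k ^ 2 * x)"
  proof -
    have "q ^ 2 \<le> (8 * k * r) ^ 2" using r(2) pos by (intro power_mono) auto
    then have "q ^ 2 / r ^ 2 \<le> 64 * k ^ 2" using r0 by (simp add: power_mult_distrib field_simps)
    then have "8 * x * (q ^ 2 / r ^ 2) \<le> 8 * x * (64 * k ^ 2)"
      using xy by (intro mult_left_mono) auto
    moreover have "8 * q ^ 3 * b / r ^ 2 = 8 * x * (q ^ 2 / r ^ 2)"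
      by (simp add: power3_eq_cube power2_eq_square qb[symmetric])
    moreover have "8 * x * (64 * k ^ 2) = 512 * (k ^ 2 * x)" by simp
    ultimately show ?thesis by (simp only:)
  qed
  have qx: "200000 * (R * (k ^ 3 * x)) \<le> y"
  proof -
    have "200000 * R * k ^ 4 * x \<le> q * x" using q xy by (intro mult_right_mono) auto
    moreover have "200000 * R * k ^ 4 * x = 200000 * (R * (k ^ 3 * x)) * k"
      by (simp add: power_numeral_reduce)
    moreover have "q * x = y * k" using xy by (simp add: mult.commute)
    ultimately have "200000 * (R * (k ^ 3 * x)) * k \<le> y * k" by (simp only:)
    then show ?thesis using pos by simp
  qed
  have powers: "x \<le> k * x" "k * x \<le> k ^ 2 * x" "k ^ 2 * x \<le> k ^ 3 * x" "k ^ 3 * x \<le> R * (k ^ 3 * x)"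
  proof -
    have mono: "z \<le> k * z" if "0 < z" for z using that k by simp
    show "x \<le> k * x" "k * x \<le> k ^ 2 * x" "k ^ 2 * x \<le> k ^ 3 * x"
      using mono[of x] mono[of "k * x"] mono[of "k ^ 2 * x"] xy pos
      by (simp_all add: power2_eq_square power3_eq_cube mult.assoc)
    show "k ^ 3 * x \<le> R * (k ^ 3 * x)" using R xy pos by simp
  qed
  have rb': "4 * (r * b) \<le> x"
  proof -
    have "r * b \<le> k * (r * b)" using k r0 b by simp
    then show ?thesis using rb by linarith
  qed
  have ny: "1200 * (k * n) \<le> y" "y \<le> 1201 * (k * n)"
  proof -
    have "1200 * (k * n) * k \<le> y * k" "y * k \<le> 1201 * (k * n) * k"
      using N(2,3) xy(4) by (simp_all add: power2_eq_square mult_ac)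
    then show "1200 * (k * n) \<le> y" "y \<le> 1201 * (k * n)" using pos by (simp_all add: mult.commute)
  qed
  have xn: "x \<le> n"
  proof -
    have "2000 * (k ^ 3 * x) \<le> y" using qx powers xy by linarith
    also note ny(2)
    also have "2000 * (k ^ 3 * x) = 2000 * (k ^ 2 * x) * k"
      by (simp add: power3_eq_cube power2_eq_square)
    also have "1201 * (k * n) = 1201 * n * k" by simp
    finally have "2000 * (k ^ 2 * x) * k \<le> 1201 * n * k" .
    then have "2000 * (k ^ 2 * x) \<le> 1201 * n" using pos by simp
    then show ?thesis using powers pos by linarith
  qed
  have kn: "2 * n \<le> k * n" using k pos by simp
  show "r * b \<le> 2 * (n + k)" unfolding distrib_left using rb' xn pos by linarith
  show "4 * (n + k) + r * b \<le> r * q * b"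
    unfolding distrib_left using rb' xn rqb_low kn ny(1) k pos by linarith
  have low: "y / 72 \<le> r * q * b / 9" using rqb_low by linarith
  have "k * (2 * (n + k)) \<le> k * (4 * n)" using k pos by (intro mult_left_mono) auto
  also have "\<dots> = 4 * (k * n)" by simp
  \<comment> \<open>The degree threshold \<open>2 * (n + k)\<close> is the only term not made small
    by \<open>q\<close>; the factor 1200 in \<open>N\<close> absorbs it.\<close>
  finally have t2: "300 * (k * (2 * (n + k))) \<le> y" using ny(1) by linarith
  have "k * (8 * q ^ 3 * b / r ^ 2) \<le> k * (512 * (k ^ 2 * x))"
    using bad pos by (intro mult_left_mono) auto
  also have "\<dots> = 512 * (k ^ 3 * x)" by (simp add: power3_eq_cube power2_eq_square)
  finally have t3: "390 * (k * (8 * q ^ 3 * b / r ^ 2)) \<le> y"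
    using qx powers xy by linarith
  have t1: "4000 * (k * (r * b)) \<le> y" using rb qx powers xy by linarith
  have "k * (r * b + 2 * (n + k) + 8 * q ^ 3 * b / r ^ 2)
      = k * (r * b) + k * (2 * (n + k)) + k * (8 * q ^ 3 * b / r ^ 2)" by (simp only: distrib_left)
  also have "\<dots> < y / 72" using t1 t2 t3 xy(2) by linarith
  finally show "k * (r * b + 2 * (n + k) + 8 * q ^ 3 * b / r ^ 2) < r * q * b / 9"
    using low by linarith
  have "r * b + 8 * q ^ 3 * b / r ^ 2 \<le> 513 * (k ^ 3 * x)"
    using rb' bad powers xy by linarith
  then have "R * (r * b + 8 * q ^ 3 * b / r ^ 2) \<le> R * (513 * (k ^ 3 * x))"
    using R by (intro mult_left_mono) auto
  also have "\<dots> = 513 * (R * (k ^ 3 * x))" by simp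
  also have "\<dots> < y / 72" using qx xy(2) by linarith
  finally show "R * (r * b + 8 * q ^ 3 * b / r ^ 2) < r * q * b / 9" using low by linarith
  have "N * (r * q * b) \<le> (1201 * k ^ 2 * n) * (1201 * (k * n) / 4)"
    using N(3) rqb_up ny(2) pos r0 b by (intro mult_mono) auto
  also have "\<dots> = 1442401 / 4 * (k ^ 3 * n ^ 2)"
    by (simp add: power3_eq_cube power2_eq_square)
  \<comment> \<open>\<open>1201 ^ 2 / 4\<close> is about 360600.\<close>
  also have "\<dots> \<le> 400000 * (k ^ 3 * n ^ 2)" using pos by (intro mult_right_mono) auto
  finally show "N * (r * q * b) \<le> 400000 * k ^ 3 * n ^ 2" by (simp only: mult.assoc)
qed

text \<open>The Ramsey number \<open>R\<close>, the prime \<open>q\<close> and the number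
  \<open>r\<close> of classes depend only on \<open>k\<close>; the growth with \<open>n\<close> is
  carried by the blow-up factor \<open>b\<close> alone.\<close>

lemma ramsey_graph_upper_bound:
  fixes k :: nat
  assumes k: "2 \<le> k"
  obtains n0 where "\<And>n. n0 \<le> n \<Longrightarrow> \<exists>G :: nat graph. simple_graph G \<and>
    is_ramsey_for G (starburst k n) \<and> real (card (edges G)) \<le> 400000 * real k ^ 3 * real n ^ 2"
proof -
  obtain R where R: "1 \<le> R" "\<And>(W :: nat set) E. finite W \<Longrightarrow> R \<le> card W \<Longrightarrow>
      \<exists>K\<subseteq>W. card K = k \<and> clique K E \<or> card K = k \<and> indep K E"
    using ramsey2[of k k, where 'a = nat] by blast
  obtain q where q: "prime q" "200000 * R * k ^ 4 < q"
    using bigger_prime by blast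
  \<comment> \<open>The largest \<open>r\<close> allowed by \<open>4 * k * r \<le> q\<close>; as
    \<open>q \<ge> 8 * k\<close>, rounding down loses at most a factor of 2.\<close>
  define r where "r = q div (4 * k)"
  have k4: "8 * k \<le> k ^ 4"
    using power_mono[of 2 k 3] k by (simp add: power_numeral_reduce)
  have "k ^ 4 \<le> R * k ^ 4" using R(1) by simp
  then have qk: "8 * k \<le> q" using q(2) k4 by linarith
  have kr: "4 * k * r \<le> q" by (simp add: r_def)
  have r2: "2 \<le> r" unfolding r_def using qk k
    by (subst less_eq_div_iff_mult_less_eq) auto
  have "q < 4 * k * (r + 1)"
    unfolding r_def using k dividend_less_times_div[of "4 * k" q] by simp
  also have "\<dots> \<le> 8 * k * r" using r2 by simp
  finally have qr: "q \<le> 8 * k * r" by simp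
  have "r \<le> q" by (simp add: r_def)
  show ?thesis
  \<comment> \<open>The summand \<open>q ^ 2\<close> lets \<open>n\<close> absorb the rounding of
    \<open>b\<close>, whence 1201 instead of 1200; the summand \<open>k\<close> gives
    \<open>k \<le> n\<close>.\<close>
  proof (rule that[of "q ^ 2 + k"])
    fix n assume n: "q ^ 2 + k \<le> n"
    define b where "b = 1200 * k ^ 2 * n div q ^ 2 + 1"
    interpret orthogonal_array "{..<q * q * b}" "plane_line q" r q b
      by (rule plane_orthogonal_array) fact+
    have N: "1200 * k ^ 2 * n \<le> q ^ 2 * b" "q ^ 2 * b \<le> 1201 * k ^ 2 * n"
    proof -
      have "1200 * k ^ 2 * n < q ^ 2 * b"
        unfolding b_def using levels dividend_less_times_div[of "q ^ 2" "1200 * k ^ 2 * n"] by simp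
      then show "1200 * k ^ 2 * n \<le> q ^ 2 * b" by simp
      have "q ^ 2 * b \<le> 1200 * k ^ 2 * n + q ^ 2"
        unfolding b_def using times_div_less_eq_dividend[of "q ^ 2" "1200 * k ^ 2 * n"] by simp
      also have "q ^ 2 \<le> n" using n by simp
      also have "1200 * k ^ 2 * n + n \<le> 1201 * k ^ 2 * n" using k by simp
      finally show "q ^ 2 * b \<le> 1201 * k ^ 2 * n" by simp
    qed
    have prem: "2 \<le> real k" "real k \<le> real n" "1 \<le> real R"
      "200000 * real R * real k ^ 4 \<le> real q" "4 * real k * real r \<le> real q"
      "real q \<le> 8 * real k * real r" "0 < real b"
      using k n R(1) of_nat_mono[OF less_imp_le[OF q(2)], where 'a = real]
        of_nat_mono[OF kr, where 'a = real] of_nat_mono[OF qr, where 'a = real]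
      by (simp_all add: b_def)
    have prem_N: "real (q ^ 2 * b) = real q ^ 2 * real b"
      "1200 * real k ^ 2 * real n \<le> real (q ^ 2 * b)" "real (q ^ 2 * b) \<le> 1201 * real k ^ 2 * real n"
      using of_nat_mono[OF N(1), where 'a = real] of_nat_mono[OF N(2), where 'a = real] by simp_all
    note num = ramsey_numerics[OF prem prem_N]
    have "is_ramsey_for line_graph (starburst k n)"
    proof (rule is_ramsey_for_line_graph[of k n R])
      show "0 < k" "0 < b" using k by (simp_all add: b_def)
      show "4 * k * r \<le> q" by (rule kr)
      have "real (r * b) \<le> real (2 * (n + k))" using num(1) by simp
      then show "r * b \<le> 2 * (n + k)" by (simp only: of_nat_le_iff)
      have "real (2 * (2 * (n + k)) + r * b) \<le> real (r * q * b)" using num(2) by simp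
      then show "2 * (2 * (n + k)) + r * b \<le> r * q * b" by (simp only: of_nat_le_iff)
      show "\<exists>K\<subseteq>W. card K = k \<and> clique K E \<or> card K = k \<and> indep K E"
        if "finite W" "R \<le> card W" for W :: "nat set" and E
        using R(2)[OF that] .
      show "real k * (real r * real b + real (2 * (n + k)) + 8 * real q ^ 3 * real b / real r ^ 2)
          < real r * real q * real b / 9" using num(3) by simp
      show "real R * (real r * real b + 8 * real q ^ 3 * real b / real r ^ 2)
          < real r * real q * real b / 9" by (rule num(4))
    qed
    moreover have "real (card (edges line_graph)) \<le> 400000 * real k ^ 3 * real n ^ 2"
    proof -
      have "real (card (edges line_graph)) \<le> real (card {..<q * q * b} * (r * q * b))"
        using card_edges_line_graph by (rule of_nat_mono)
      also have "\<dots> = real (q ^ 2 * b) * (real r * real q * real b)"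
        by (simp add: power2_eq_square)
      finally show ?thesis using num(5) by linarith
    qed
    ultimately show "\<exists>G :: nat graph. simple_graph G \<and> is_ramsey_for G (starburst k n) \<and>
        real (card (edges G)) \<le> 400000 * real k ^ 3 * real n ^ 2"
      using simple_graph_line_graph by blast
  qed
qed

theorem theorem1p4:
  shows "\<exists>c C :: real. 0 < c \<and> 0 < C \<and>
    (\<forall>k::nat. 2 \<le> k \<longrightarrow> (\<exists>n0::nat. \<forall>n::nat. n0 \<le> n \<longrightarrow>
      c * real k ^ 3 * real n ^ 2 \<le> real (size_ramsey (starburst k n)) \<and>
      real (size_ramsey (starburst k n)) \<le> C * real k ^ 3 * real n ^ 2))"
proof (rule exI[of _ "1 / 72"], rule exI[of _ 400000], intro conjI allI impI)
  show "0 < (1 / 72 :: real)" "0 < (400000 :: real)" by simp_all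
next
  fix k :: nat
  assume k: "2 \<le> k"
  obtain n0 where n0: "\<And>n. n0 \<le> n \<Longrightarrow> \<exists>G :: nat graph. simple_graph G \<and>
    is_ramsey_for G (starburst k n) \<and> real (card (edges G)) \<le> 400000 * real k ^ 3 * real n ^ 2"
    using ramsey_graph_upper_bound[OF k] by blast
  have "1 / 72 * real k ^ 3 * real n ^ 2 \<le> real (size_ramsey (starburst k n)) \<and>
      real (size_ramsey (starburst k n)) \<le> 400000 * real k ^ 3 * real n ^ 2" if n: "n0 \<le> n" for n
  proof -
    let ?P = "\<lambda>m. \<exists>G :: nat graph. simple_graph G \<and> is_ramsey_for G (starburst k n) \<and>
      card (edges G) = m"
    obtain G :: "nat graph" where G: "simple_graph G" "is_ramsey_for G (starburst k n)"
      "real (card (edges G)) \<le> 400000 * real k ^ 3 * real n ^ 2"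
      using n0[OF n] by blast
    have P: "?P (card (edges G))" using G by blast
    have "size_ramsey (starburst k n) \<le> card (edges G)"
      unfolding size_ramsey_def by (rule Least_le) (rule P)
    \<comment> \<open>The host graph from the upper bound shows that the minimum is attained, so the
      lower bound applies to an optimal graph.\<close>
    moreover have "?P (size_ramsey (starburst k n))"
      unfolding size_ramsey_def by (rule LeastI) (rule P)
    then obtain G' :: "nat graph" where "simple_graph G'" "is_ramsey_for G' (starburst k n)"
      "card (edges G') = size_ramsey (starburst k n)" by blast
    then have "real k ^ 3 * real n ^ 2 / 72 \<le> real (size_ramsey (starburst k n))"
      using ramsey_edges_lower_bound[OF _ _ k, of G' n] by simp
    ultimately show ?thesis using G(3) by simp
  qed
  then show "\<exists>n0. \<forall>n\<ge>n0. 1 / 72 * real k ^ 3 * real n ^ 2 \<le> real (size_ramsey (starburst k n)) \<and>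
      real (size_ramsey (starburst k n)) \<le> 400000 * real k ^ 3 * real n ^ 2" by blast
qed

end
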